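(* Let $p$ and $q$ be Ising models on $n$ nodes, both in the high-temperature regime and with no external field, with all edge parameters of absolute value at most $\beta$. There is an algorithm which, given a description of $q$ and $\tilde O\!\left(\frac{n^{10/3}\beta^2}{\varepsilon^2}\right)$ i.i.d. samples from $p$, distinguishes between the cases $p=q$ and $d_{\mathrm{SKL}}(p,q)\ge\varepsilon$ with probability at least $9/10$.
   Context: An Ising model on vertex set $V$, $|V|=n$, is the distribution on $\{-1,1\}^V$ with $p(x)\propto\exp\big(\sum_{v}\theta_v x_v+\sum_{u\ne v}\theta_{uv}x_ux_v\big)$. "No external field" means $\theta_v=0$ for all $v$. High-temperature regime: $\max_{v}\sum_{u\ne v}\tanh(|\theta_{uv}|)\le1-\eta$ for some constant $\eta>0$. $d_{\mathrm{SKL}}(p,q)=d_{\mathrm{KL}}(p\|q)+d_{\mathrm{KL}}(q\|p)$. A description of $q$ consists of its parameters and its marginals $\mathbf{E}_q[X_uX_v]$, $\mathbf{E}_q[X_u]$. $\tilde O$ hides polylogarithmic factors. *)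

theory Defs
  imports "HOL-Probability.Probability"
begin

section \<open>Ising models\<close>

text \<open>
  The vertex set is \<open>{..<n}\<close>. A model has node parameters \<open>h v\<close> and edge parameters \<open>J u v\<close>.
  There is one parameter per unordered pair of distinct vertices, so \<open>J\<close> is a symmetric
  matrix with zero diagonal and every pair is counted once in the exponent.
\<close>

definition ising_params :: "nat \<Rightarrow> (nat \<Rightarrow> real) \<Rightarrow> (nat \<Rightarrow> nat \<Rightarrow> real) \<Rightarrow> bool" where
  "ising_params n h J \<longleftrightarrow> (\<forall>u<n. \<forall>v<n. J u v = J v u) \<and> (\<forall>v<n. J v v = 0)"

definition spins :: "nat \<Rightarrow> (nat \<Rightarrow> real) set" where
  "spins n = {..<n} \<rightarrow>\<^sub>E {-1, 1}"

definition ising_weight ::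
    "nat \<Rightarrow> (nat \<Rightarrow> real) \<Rightarrow> (nat \<Rightarrow> nat \<Rightarrow> real) \<Rightarrow> (nat \<Rightarrow> real) \<Rightarrow> real" where
  "ising_weight n h J x = exp ((\<Sum>v<n. h v * x v) + (\<Sum>v<n. \<Sum>u<v. J u v * x u * x v))"

definition ising_partition :: "nat \<Rightarrow> (nat \<Rightarrow> real) \<Rightarrow> (nat \<Rightarrow> nat \<Rightarrow> real) \<Rightarrow> real" where
  "ising_partition n h J = (\<Sum>x\<in>spins n. ising_weight n h J x)"

definition ising :: "nat \<Rightarrow> (nat \<Rightarrow> real) \<Rightarrow> (nat \<Rightarrow> nat \<Rightarrow> real) \<Rightarrow> (nat \<Rightarrow> real) pmf" where
  "ising n h J =
     embed_pmf (\<lambda>x. if x \<in> spins n then ising_weight n h J x / ising_partition n h J else 0)"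

definition no_external_field :: "nat \<Rightarrow> (nat \<Rightarrow> real) \<Rightarrow> bool" where
  "no_external_field n h \<longleftrightarrow> (\<forall>v<n. h v = 0)"

definition high_temperature :: "real \<Rightarrow> nat \<Rightarrow> (nat \<Rightarrow> nat \<Rightarrow> real) \<Rightarrow> bool" where
  "high_temperature \<eta> n J \<longleftrightarrow> (\<forall>v<n. (\<Sum>u\<in>{..<n} - {v}. tanh \<bar>J u v\<bar>) \<le> 1 - \<eta>)"

definition edges_bounded :: "real \<Rightarrow> nat \<Rightarrow> (nat \<Rightarrow> nat \<Rightarrow> real) \<Rightarrow> bool" where
  "edges_bounded \<beta> n J \<longleftrightarrow> (\<forall>u<n. \<forall>v<n. u \<noteq> v \<longrightarrow> \<bar>J u v\<bar> \<le> \<beta>)"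

lemma finite_spins: "finite (spins n)"
  unfolding spins_def by (intro finite_PiE) auto

lemma spins_nonempty: "spins n \<noteq> {}"
  unfolding spins_def by (simp add: PiE_eq_empty_iff)

lemma ising_partition_pos: "ising_partition n h J > 0"
  unfolding ising_partition_def
  by (intro sum_pos finite_spins spins_nonempty) (simp add: ising_weight_def)

lemma pmf_ising:
  "pmf (ising n h J) x =
     (if x \<in> spins n then ising_weight n h J x / ising_partition n h J else 0)"
  unfolding ising_def
proof (rule pmf_embed_pmf)
  show nonneg:
    "0 \<le> (if x \<in> spins n then ising_weight n h J x / ising_partition n h J else 0)" for x
    using ising_partition_pos[of n h J] by (simp add: ising_weight_def)
  have "(\<integral>\<^sup>+x. ennreal (if x \<in> spins n then ising_weight n h J x / ising_partition n h J else 0)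
          \<partial>count_space UNIV) =
        (\<Sum>x\<in>spins n. ennreal (ising_weight n h J x / ising_partition n h J))"
    by (subst nn_integral_count_space'[of "spins n"]) (auto simp: finite_spins)
  also have "\<dots> = ennreal (\<Sum>x\<in>spins n. ising_weight n h J x / ising_partition n h J)"
    using ising_partition_pos[of n h J] by (intro sum_ennreal) (simp add: ising_weight_def)
  also have "(\<Sum>x\<in>spins n. ising_weight n h J x / ising_partition n h J) = 1"
    using ising_partition_pos[of n h J]
    by (simp add: ising_partition_def flip: sum_divide_distrib)
  finally show "(\<integral>\<^sup>+x. ennreal (if x \<in> spins n then ising_weight n h J x / ising_partition n h J
          else 0) \<partial>count_space UNIV) = 1"
    by simp
qed

lemma set_pmf_ising: "set_pmf (ising n h J) = spins n"
  using ising_partition_pos[of n h J] by (auto simp: set_pmf_eq pmf_ising ising_weight_def)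


section \<open>Symmetric Kullback--Leibler divergence\<close>

text \<open>
  The library constant \<open>KL_divergence b M N\<close> integrates with respect to its last argument, so
  \<open>KL_divergence (exp 1) q p\<close> is the divergence of \<open>p\<close> from \<open>q\<close> (in nats).
\<close>

definition d_KL :: "'a pmf \<Rightarrow> 'a pmf \<Rightarrow> real" where
  "d_KL p q = KL_divergence (exp 1) (measure_pmf q) (measure_pmf p)"

definition d_SKL :: "'a pmf \<Rightarrow> 'a pmf \<Rightarrow> real" where
  "d_SKL p q = d_KL p q + d_KL q p"

lemma d_KL_finite:
  assumes "set_pmf p = set_pmf q" "finite (set_pmf q)"
  shows "d_KL p q = (\<Sum>x\<in>set_pmf q. pmf p x * ln (pmf p x / pmf q x))"
proof -
  have eq: "measure_pmf p = density (measure_pmf q) (\<lambda>x. ennreal (pmf p x / pmf q x))"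
  proof -
    have "density (measure_pmf q) (\<lambda>x. ennreal (pmf p x / pmf q x)) =
          density (count_space UNIV) (\<lambda>x. ennreal (pmf q x) * ennreal (pmf p x / pmf q x))"
      unfolding measure_pmf_eq_density[of q] by (subst density_density_eq) auto
    also have "(\<lambda>x. ennreal (pmf q x) * ennreal (pmf p x / pmf q x)) = (\<lambda>x. ennreal (pmf p x))"
    proof
      fix x
      show "ennreal (pmf q x) * ennreal (pmf p x / pmf q x) = ennreal (pmf p x)"
      proof (cases "x \<in> set_pmf q")
        case True
        then show ?thesis
          by (simp add: pmf_positive less_imp_neq[THEN not_sym] flip: ennreal_mult')
      next
        case False
        then have "pmf p x = 0" "pmf q x = 0"
          using assms(1) by (auto simp: set_pmf_iff)
        then show ?thesis by simp
      qed
    qed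
    also have "density (count_space UNIV) (\<lambda>x. ennreal (pmf p x)) = measure_pmf p"
      by (simp add: measure_pmf_eq_density)
    finally show ?thesis by simp
  qed
  have "d_KL p q = (\<integral>x. pmf p x / pmf q x * log (exp 1) (pmf p x / pmf q x) \<partial>measure_pmf q)"
    unfolding d_KL_def
    by (subst eq, rule sigma_finite_measure.KL_density)
       (auto simp: measure_pmf.sigma_finite_measure_axioms)
  also have "\<dots> = (\<Sum>x\<in>set_pmf q.
      pmf p x / pmf q x * log (exp 1) (pmf p x / pmf q x) * pmf q x)"
    using assms(2) by (intro integral_measure_pmf_real) auto
  also have "\<dots> = (\<Sum>x\<in>set_pmf q. pmf p x * ln (pmf p x / pmf q x))"
    by (intro sum.cong refl) (auto simp: log_def set_pmf_iff)
  finally show ?thesis .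
qed


section \<open>Algorithms\<close>

text \<open>
  Algorithms are programs for a deterministic real-number machine with exact arithmetic, order
  comparisons, integer constants, indirect access to an input array of reals, and counted loops.
  Variables are de Bruijn indices: \<open>Loop N a b\<close> starts with the value of \<open>a\<close> and runs
  \<open>b\<close> once for each \<open>i < N\<close>, with \<open>Var 0\<close> bound to \<open>i\<close> and \<open>Var 1\<close> to the
  accumulated value. Every program terminates on every input. One program handles inputs of all
  sizes, and there are no constants that could hide non-computable information.
\<close>

datatype prog =
    Const int
  | Var nat
  | Input prog
  | Add prog prog
  | Sub prog prog
  | Mult prog prog
  | Div prog prog
  | IfLess prog prog prog prog
  | Loop prog prog prog

definition lookup :: "real list \<Rightarrow> nat \<Rightarrow> real" where
  "lookup xs i = (if i < length xs then xs ! i else 0)"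

primrec exec :: "real list \<Rightarrow> prog \<Rightarrow> real list \<Rightarrow> real" where
  "exec xs (Const c) env = of_int c"
| "exec xs (Var i) env = lookup env i"
| "exec xs (Input a) env = lookup xs (nat \<lfloor>exec xs a env\<rfloor>)"
| "exec xs (Add a b) env = exec xs a env + exec xs b env"
| "exec xs (Sub a b) env = exec xs a env - exec xs b env"
| "exec xs (Mult a b) env = exec xs a env * exec xs b env"
| "exec xs (Div a b) env = exec xs a env / exec xs b env"
| "exec xs (IfLess a b c d) env =
     (if exec xs a env < exec xs b env then exec xs c env else exec xs d env)"
| "exec xs (Loop N a b) env =
     rec_nat (exec xs a env) (\<lambda>i acc. exec xs b (real i # acc # env)) (nat \<lfloor>exec xs N env\<rfloor>)"

definition run :: "prog \<Rightarrow> real list \<Rightarrow> real" where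
  "run A xs = exec xs A []"


section \<open>Identity testers\<close>

definition matrix_list :: "nat \<Rightarrow> nat \<Rightarrow> (nat \<Rightarrow> nat \<Rightarrow> real) \<Rightarrow> real list" where
  "matrix_list r c M = map (\<lambda>k. M (k div c) (k mod c)) [0..<r * c]"

text \<open>The description of the model \<open>q\<close>: its parameters and its marginals.\<close>

definition ising_description ::
    "nat \<Rightarrow> (nat \<Rightarrow> real) \<Rightarrow> (nat \<Rightarrow> nat \<Rightarrow> real) \<Rightarrow> real list" where
  "ising_description n h J =
     (let q = measure_pmf (ising n h J) in
       map h [0..<n] @ matrix_list n n J @
       map (\<lambda>v. \<integral>x. x v \<partial>q) [0..<n] @ matrix_list n n (\<lambda>u v. \<integral>x. x u * x v \<partial>q))"

text \<open>\<open>X i v\<close> is the spin of vertex \<open>v\<close> in the \<open>i\<close>-th of \<open>m\<close> samples.\<close>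

definition tester_input ::
    "nat \<Rightarrow> real \<Rightarrow> real \<Rightarrow> nat \<Rightarrow> real list \<Rightarrow> (nat \<Rightarrow> nat \<Rightarrow> real) \<Rightarrow> real list" where
  "tester_input n \<beta> \<epsilon> m descr X = [real n, \<beta>, \<epsilon>, real m] @ descr @ matrix_list m n X"

definition iid_samples :: "nat \<Rightarrow> 'a pmf \<Rightarrow> (nat \<Rightarrow> 'a) pmf" where
  "iid_samples m p = Pi_pmf {..<m} undefined (\<lambda>_. p)"

text \<open>
  An explicit function of order \<open>\<tilde>O(f)\<close>, meaning \<open>O(f log^k f)\<close> for some \<open>k\<close>,
  with \<open>f = n^(10/3) \<beta>^2 / \<epsilon>^2\<close>; the shift by 2 keeps the logarithm positive.
\<close>

definition sample_size :: "real \<Rightarrow> nat \<Rightarrow> nat \<Rightarrow> real \<Rightarrow> real \<Rightarrow> nat" where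
  "sample_size C k n \<beta> \<epsilon> =
     (let f = real n powr (10 / 3) * \<beta>\<^sup>2 / \<epsilon>\<^sup>2 in nat \<lceil>C * f * ln (2 + f) ^ k\<rceil>)"

end

theory Submission
  imports Defs
begin

text \<open>
  The divergence is \<open>d_SKL p q = (\<Sum>u<v. (Jp u v - Jq u v) * \<Delta> u v)\<close>, where \<open>\<Delta> u v\<close> is the difference
  of the correlations, so \<open>d_SKL p q \<ge> \<epsilon>\<close> forces \<open>D = (\<Sum>u v. (\<Delta> u v)\<^sup>2) \<ge> \<epsilon>\<^sup>2 / (4 \<beta>\<^sup>2 n\<^sup>2)\<close> by
  Cauchy--Schwarz. The tester estimates \<open>D\<close> by the inner product of the empirical correlation errors
  on two independent halves of the sample.

  The variance of this estimate is controlled by the variances of quadratic forms under \<open>p\<close>. At high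
  temperature the heat-bath dynamics contracts the total oscillation by \<open>1 - \<eta> / n\<close> per step. Since
  the transition operator is self-adjoint, the squared norms of the iterates are log-convex, so the
  contraction rate bounds the very first step as well. This is a Poincare inequality. Applied twice,
  it bounds the variance of \<open>\<Sum>u v. a u v * x u * x v\<close> by \<open>(4 / \<eta>\<^sup>2) * (\<Sum>u v. (a u v)\<^sup>2)\<close>, and Chebyshev's
  inequality then needs only \<open>O(n\<^sup>3 \<beta>\<^sup>2 / \<epsilon>\<^sup>2)\<close> samples, with no logarithmic factor.
\<close>

section \<open>The Poincare inequality under the Dobrushin condition\<close>

text \<open>Log-convexity makes the successive ratios of \<open>b\<close> nondecreasing, so a first
  ratio above \<open>r\<close> would force growth faster than \<open>M * r ^ j\<close>. An
  asymptotic rate thus controls the very first step, whatever the size of \<open>M\<close>.\<close>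

lemma ratio_le_of_log_convex:
  fixes b :: "nat \<Rightarrow> real"
  assumes nonneg: "\<And>j. 0 \<le> b j" and conv: "\<And>j. (b (Suc j))\<^sup>2 \<le> b j * b (Suc (Suc j))"
    and bound: "\<And>j. b j \<le> M * r ^ j" and r: "0 \<le> r"
  shows "b 1 \<le> r * b 0"
proof (rule ccontr)
  assume less: "\<not> b 1 \<le> r * b 0"
  have b0: "b 0 > 0"
  proof (rule ccontr)
    assume "\<not> b 0 > 0"
    then have "b 0 = 0" using nonneg[of 0] by simp
    then have "b 1 = 0" using conv[of 0] by simp
    with less \<open>b 0 = 0\<close> show False by simp
  qed
  define s where "s = b 1 / b 0"
  have s: "r < s" using less b0 by (simp add: s_def field_simps)
  have growth: "0 < b j \<and> s * b j \<le> b (Suc j)" for j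
  proof (induction j)
    case 0
    then show ?case using b0 by (simp add: s_def)
  next
    case (Suc j)
    have pos: "0 < b (Suc j)" using Suc s r
      by (meson less_le_trans mult_pos_pos order_le_less_trans)
    have "b j * (s * b (Suc j)) = (s * b j) * b (Suc j)" by simp
    also have "\<dots> \<le> b (Suc j) * b (Suc j)" using Suc pos by (intro mult_right_mono) auto
    also have "\<dots> \<le> b j * b (Suc (Suc j))" using conv[of j] by (simp add: power2_eq_square)
    finally show ?case using Suc pos by simp
  qed
  have lower: "s ^ j * b 0 \<le> b j" for j
  proof (induction j)
    case (Suc j)
    have "s ^ Suc j * b 0 = s * (s ^ j * b 0)" by simp
    also have "\<dots> \<le> s * b j" using Suc s r by (intro mult_left_mono) auto
    also have "\<dots> \<le> b (Suc j)" using growth by blast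
    finally show ?case .
  qed simp
  \<comment> \<open>Since \<open>r < s\<close>, the right-hand side tends to 0, which contradicts
    \<open>b 0 > 0\<close>.\<close>
  have "b 0 \<le> M * (r / s) ^ j" for j
    using order_trans[OF lower bound, of j] s r by (simp add: power_divide field_simps)
  moreover have "(\<lambda>j. M * (r / s) ^ j) \<longlonglongrightarrow> M * 0"
    using s r by (intro tendsto_intros LIMSEQ_power_zero) auto
  ultimately have "b 0 \<le> M * 0" by (intro LIMSEQ_le_const) auto
  with b0 show False by simp
qed

section \<open>Spin flips and coordinatewise oscillation\<close>

definition flip_spin :: "nat \<Rightarrow> (nat \<Rightarrow> real) \<Rightarrow> nat \<Rightarrow> real" where
  "flip_spin v x = x(v := - x v)"

lemma flip_spin_flip_spin [simp]: "flip_spin v (flip_spin v x) = x"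
  by (simp add: flip_spin_def)

lemma flip_spin_commute: "flip_spin u (flip_spin v x) = flip_spin v (flip_spin u x)"
  by (auto simp: flip_spin_def fun_eq_iff)

lemma spins_cases: "x \<in> spins n \<Longrightarrow> v < n \<Longrightarrow> x v = 1 \<or> x v = -1"
  by (auto simp: spins_def PiE_iff)

lemma spins_square [simp]: "x \<in> spins n \<Longrightarrow> v < n \<Longrightarrow> x v * x v = 1"
  using spins_cases[of x n v] by auto

lemma flip_spin_in_spins [simp]: "x \<in> spins n \<Longrightarrow> v < n \<Longrightarrow> flip_spin v x \<in> spins n"
  by (auto simp: spins_def PiE_iff flip_spin_def extensional_def)

lemma sum_flip_spin: "v < n \<Longrightarrow> (\<Sum>x\<in>spins n. f (flip_spin v x)) = (\<Sum>x\<in>spins n. f x)"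
  by (rule sum.reindex_bij_witness[of _ "flip_spin v" "flip_spin v"]) auto

text \<open>The vector \<open>d\<close> need only dominate the oscillations, so upper bounds can be
  propagated through the dynamics without computing suprema.\<close>

definition osc_bound :: "nat \<Rightarrow> ((nat \<Rightarrow> real) \<Rightarrow> real) \<Rightarrow> (nat \<Rightarrow> real) \<Rightarrow> bool" where
  "osc_bound n f d \<longleftrightarrow> (\<forall>u<n. \<forall>x\<in>spins n. \<bar>f x - f (flip_spin u x)\<bar> \<le> d u)"

text \<open>The spins of \<open>x\<close> are replaced by those of \<open>y\<close> one at a time;
  each replacement is void or a single flip.\<close>

lemma osc_bound_diff:
  assumes "osc_bound n f d" "x \<in> spins n" "y \<in> spins n"
  shows "\<bar>f x - f y\<bar> \<le> (\<Sum>u<n. d u)"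
proof -
  define z where "z k = (\<lambda>i. if i < k then y i else x i)" for k
  have z_in: "z k \<in> spins n" for k
    using assms(2,3) by (auto simp: z_def spins_def PiE_iff extensional_def)
  have "\<bar>f x - f (z k)\<bar> \<le> (\<Sum>u<k. d u)" if "k \<le> n" for k
    using that
  proof (induction k)
    case 0
    then show ?case by (simp add: z_def)
  next
    case (Suc k)
    have "z (Suc k) = z k \<or> z (Suc k) = flip_spin k (z k)"
    proof -
      have "y k = x k \<or> y k = - x k"
        using spins_cases[OF assms(2), of k] spins_cases[OF assms(3), of k] Suc.prems by auto
      then show ?thesis by (auto simp: z_def flip_spin_def fun_eq_iff less_Suc_eq)
    qed
    moreover have "\<bar>f (z k) - f (flip_spin k (z k))\<bar> \<le> d k"
      using assms(1) z_in Suc.prems by (auto simp: osc_bound_def)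
    ultimately have "\<bar>f (z k) - f (z (Suc k))\<bar> \<le> d k"
      by auto
    with Suc show ?case by simp
  qed
  moreover have "z n = y"
    using assms(2,3) by (auto simp: z_def spins_def PiE_iff extensional_def fun_eq_iff)
  ultimately show ?thesis by force
qed

text \<open>The quotient \<open>\<pi> x / (\<pi> x + \<pi> (flip_spin v x))\<close> is the
  conditional probability of the spin \<open>x v\<close> given all other spins.
  \<open>influence\<close> bounds its change when spin \<open>u\<close> is flipped, and
  \<open>influence_sum\<close> is Dobrushin's condition: the total influence on each
  \<open>v\<close> stays below 1 by the margin \<open>\<eta>\<close>.\<close>

locale dobrushin =
  fixes n :: nat and \<pi> :: "(nat \<Rightarrow> real) \<Rightarrow> real" and c :: "nat \<Rightarrow> nat \<Rightarrow> real" and \<eta> :: real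
  assumes n_pos: "0 < n"
    and weight_pos: "x \<in> spins n \<Longrightarrow> 0 < \<pi> x"
    and weight_sum: "(\<Sum>x\<in>spins n. \<pi> x) = 1"
    and influence: "\<lbrakk>x \<in> spins n; u < n; v < n; u \<noteq> v\<rbrakk> \<Longrightarrow>
      \<bar>\<pi> x / (\<pi> x + \<pi> (flip_spin v x))
        - \<pi> (flip_spin u x) / (\<pi> (flip_spin u x) + \<pi> (flip_spin v (flip_spin u x)))\<bar> \<le> c u v"
    and influence_sum: "v < n \<Longrightarrow> (\<Sum>u\<in>{..<n} - {v}. c u v) \<le> 1 - \<eta>"
    and eta_pos: "0 < \<eta>"
begin

section \<open>Reversibility of the heat-bath dynamics\<close>

definition ip :: "((nat \<Rightarrow> real) \<Rightarrow> real) \<Rightarrow> ((nat \<Rightarrow> real) \<Rightarrow> real) \<Rightarrow> real" where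
  "ip f g = (\<Sum>x\<in>spins n. \<pi> x * (f x * g x))"

text \<open>The conditional expectation of \<open>f\<close> given all spins except the one at
  \<open>v\<close>.\<close>

definition heat_bath :: "nat \<Rightarrow> ((nat \<Rightarrow> real) \<Rightarrow> real) \<Rightarrow> (nat \<Rightarrow> real) \<Rightarrow> real" where
  "heat_bath v f x =
     (\<pi> x * f x + \<pi> (flip_spin v x) * f (flip_spin v x)) / (\<pi> x + \<pi> (flip_spin v x))"

text \<open>The transition operator of the chain that resamples a uniformly chosen vertex.\<close>

definition glauber :: "((nat \<Rightarrow> real) \<Rightarrow> real) \<Rightarrow> (nat \<Rightarrow> real) \<Rightarrow> real" where
  "glauber f x = (\<Sum>v<n. heat_bath v f x) / n"

lemma denominator_pos: "x \<in> spins n \<Longrightarrow> v < n \<Longrightarrow> 0 < \<pi> x + \<pi> (flip_spin v x)"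
  using weight_pos[of x] weight_pos[of "flip_spin v x"] by simp

lemma ip_commute: "ip f g = ip g f"
  by (simp add: ip_def mult.commute)

lemma ip_nonneg: "0 \<le> ip f f"
  unfolding ip_def using weight_pos by (intro sum_nonneg) (simp add: less_imp_le)

lemma ip_Cauchy_Schwarz: "(ip f g)\<^sup>2 \<le> ip f f * ip g g"
proof -
  have "\<pi> x * (a * b) = (sqrt (\<pi> x) * a) * (sqrt (\<pi> x) * b)" if "x \<in> spins n" for x a b
  proof -
    have "\<pi> x = sqrt (\<pi> x) * sqrt (\<pi> x)" using weight_pos[OF that] by simp
    then show ?thesis by (metis mult.assoc mult.commute)
  qed
  then have eq: "ip f g = (\<Sum>x\<in>spins n. (sqrt (\<pi> x) * f x) * (sqrt (\<pi> x) * g x))" for f g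
    unfolding ip_def by (intro sum.cong) auto
  show ?thesis
    unfolding eq[of f g] eq[of f f] eq[of g g]
    using Cauchy_Schwarz_ineq_sum[of "\<lambda>x. sqrt (\<pi> x) * f x" "\<lambda>x. sqrt (\<pi> x) * g x" "spins n"]
    by (simp add: power2_eq_square)
qed

lemma heat_bath_flip: "heat_bath v f (flip_spin v x) = heat_bath v f x"
  by (simp add: heat_bath_def add.commute)

text \<open>\<open>heat_bath v g\<close> is constant on each pair \<open>x\<close>,
  \<open>flip_spin v x\<close>, so only the weighted sum of \<open>f\<close> over the pair matters.
  Self-adjointness follows from this projection property.\<close>

lemma ip_heat_bath_right: 
  assumes v: "v < n"
  shows "ip f (heat_bath v g) = ip (heat_bath v f) (heat_bath v g)"
proof -
  let ?h = "heat_bath v g"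
  note inv = heat_bath_flip[of v g]
  have "2 * ip f ?h = (\<Sum>x\<in>spins n. \<pi> x * (f x * ?h x))
      + (\<Sum>x\<in>spins n. \<pi> (flip_spin v x) * (f (flip_spin v x) * ?h (flip_spin v x)))"
    unfolding ip_def by (subst sum_flip_spin[OF v]) simp
  also have "\<dots> = (\<Sum>x\<in>spins n. (\<pi> x + \<pi> (flip_spin v x)) * (heat_bath v f x * ?h x))"
    unfolding sum.distrib[symmetric] inv
  proof (intro sum.cong refl)
    fix x assume "x \<in> spins n"
    from denominator_pos[OF this v]
    have "(\<pi> x + \<pi> (flip_spin v x)) * heat_bath v f x
        = \<pi> x * f x + \<pi> (flip_spin v x) * f (flip_spin v x)"
      by (simp add: heat_bath_def)
    then show "\<pi> x * (f x * ?h x) + \<pi> (flip_spin v x) * (f (flip_spin v x) * ?h x)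
        = (\<pi> x + \<pi> (flip_spin v x)) * (heat_bath v f x * ?h x)"
      by (metis (no_types, opaque_lifting) distrib_right mult.assoc)
  qed
  also have "\<dots> = (\<Sum>x\<in>spins n. \<pi> x * (heat_bath v f x * ?h x))
      + (\<Sum>x\<in>spins n. \<pi> (flip_spin v x) * (heat_bath v f (flip_spin v x) * ?h (flip_spin v x)))"
    unfolding sum.distrib[symmetric]
    by (simp add: inv distrib_right heat_bath_flip)
  also have "\<dots> = 2 * ip (heat_bath v f) ?h"
    unfolding ip_def by (subst sum_flip_spin[OF v]) simp
  finally show ?thesis by simp
qed

lemma ip_heat_bath: "v < n \<Longrightarrow> ip f (heat_bath v g) = ip (heat_bath v f) g"
  by (metis ip_heat_bath_right ip_commute)

lemma ip_glauber_right: "ip f (glauber g) = (\<Sum>v<n. ip f (heat_bath v g)) / n"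
proof -
  have "ip f (glauber g) = (\<Sum>x\<in>spins n. \<Sum>v<n. \<pi> x * (f x * heat_bath v g x)) / n"
    by (simp add: ip_def glauber_def sum_divide_distrib sum_distrib_left)
  then show ?thesis by (subst (asm) sum.swap) (simp add: ip_def)
qed

lemma ip_glauber: "ip f (glauber g) = ip (glauber f) g"
proof -
  have "ip f (heat_bath v g) = ip g (heat_bath v f)" if "v < n" for v
    using ip_heat_bath[OF that, of f g] by (simp only: ip_commute[of g])
  then show ?thesis
    unfolding ip_commute[of "glauber f"] ip_glauber_right by simp
qed

lemma glauber_one: "x \<in> spins n \<Longrightarrow> glauber (\<lambda>_. 1) x = 1"
proof -
  assume x: "x \<in> spins n"
  have "heat_bath v (\<lambda>_. 1) x = 1" if "v < n" for v
    using denominator_pos[OF x that] by (simp add: heat_bath_def)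
  then show ?thesis using n_pos by (simp add: glauber_def)
qed

text \<open>Stationarity of \<open>\<pi>\<close>: the operator is self-adjoint and fixes
  constants.\<close>

lemma ip_one_glauber: "ip (\<lambda>_. 1) (glauber f) = ip (\<lambda>_. 1) f"
  unfolding ip_glauber by (auto simp: ip_def glauber_one intro!: sum.cong)

text \<open>Symmetrizing over each flip pair turns the left side into half a sum of squared
  differences with weights \<open>r x\<close>. By the AM-GM inequality \<open>r x\<close> is at most
  a quarter of the mass of the pair.\<close>

lemma ip_heat_bath_gap:
  assumes v: "v < n"
  shows "ip f f - ip f (heat_bath v f) \<le> (\<Sum>x\<in>spins n. \<pi> x * (f x - f (flip_spin v x))\<^sup>2) / 4"
proof -
  let ?F = "flip_spin v"
  define r where "r x = \<pi> x * \<pi> (?F x) / (\<pi> x + \<pi> (?F x))" for x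
  have diff: "ip f f - ip f (heat_bath v f) = (\<Sum>x\<in>spins n. r x * (f x * (f x - f (?F x))))"
    unfolding ip_def sum_subtractf[symmetric]
  proof (intro sum.cong refl)
    fix x assume "x \<in> spins n"
    from denominator_pos[OF this v]
    show "\<pi> x * (f x * f x) - \<pi> x * (f x * heat_bath v f x) = r x * (f x * (f x - f (?F x)))"
      by (simp add: heat_bath_def r_def divide_simps) (simp add: algebra_simps)
  qed
  have "2 * (ip f f - ip f (heat_bath v f))
      = (\<Sum>x\<in>spins n. r x * (f x * (f x - f (?F x))))
      + (\<Sum>x\<in>spins n. r (?F x) * (f (?F x) * (f (?F x) - f (?F (?F x)))))"
    unfolding diff by (subst sum_flip_spin[OF v]) simp
  also have "\<dots> = (\<Sum>x\<in>spins n. r x * (f x - f (?F x))\<^sup>2)"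
    unfolding sum.distrib[symmetric]
  proof (intro sum.cong refl)
    fix x
    have "r (?F x) = r x" by (simp add: r_def add.commute mult.commute)
    then show "r x * (f x * (f x - f (?F x))) + r (?F x) * (f (?F x) * (f (?F x) - f (?F (?F x))))
        = r x * (f x - f (?F x))\<^sup>2"
      by (simp add: power2_eq_square algebra_simps)
  qed
  also have "\<dots> \<le> (\<Sum>x\<in>spins n. (\<pi> x + \<pi> (?F x)) / 4 * (f x - f (?F x))\<^sup>2)"
  proof (intro sum_mono mult_right_mono)
    fix x assume x: "x \<in> spins n"
    have "0 \<le> (\<pi> x - \<pi> (?F x))\<^sup>2" by simp
    then have "4 * (\<pi> x * \<pi> (?F x)) \<le> (\<pi> x + \<pi> (?F x)) * (\<pi> x + \<pi> (?F x))"
      by (simp add: power2_eq_square algebra_simps)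
    then show "r x \<le> (\<pi> x + \<pi> (?F x)) / 4"
      using denominator_pos[OF x v] by (simp add: r_def pos_divide_le_eq)
  qed simp
  also have "\<dots> = (\<Sum>x\<in>spins n. \<pi> x * (f x - f (?F x))\<^sup>2) / 4
      + (\<Sum>x\<in>spins n. \<pi> (?F x) * (f (?F x) - f (?F (?F x)))\<^sup>2) / 4"
    unfolding sum_divide_distrib sum.distrib[symmetric]
    by (intro sum.cong refl) (simp add: power2_commute[of "f (?F _)"] add_divide_distrib distrib_right)
  also have "\<dots> = 2 * ((\<Sum>x\<in>spins n. \<pi> x * (f x - f (?F x))\<^sup>2) / 4)"
    by (subst sum_flip_spin[OF v]) simp
  finally show ?thesis by simp
qed

section \<open>Contraction of oscillations and the spectral gap\<close>

lemma influence_nonneg: "u < n \<Longrightarrow> v < n \<Longrightarrow> u \<noteq> v \<Longrightarrow> 0 \<le> c u v"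
  using spins_nonempty[of n] influence by (metis abs_ge_zero all_not_in_conv order_trans)

lemma eta_le_one: "\<eta> \<le> 1"
proof -
  have "0 \<le> (\<Sum>u\<in>{..<n} - {0}. c u 0)"
    using n_pos by (intro sum_nonneg influence_nonneg) auto
  with influence_sum[OF n_pos] show ?thesis by linarith
qed

text \<open>Resampling \<open>v\<close> erases the dependence on spin \<open>v\<close>. For
  \<open>u \<noteq> v\<close> the change splits into an average of flips of \<open>f\<close> at
  \<open>u\<close>, costing \<open>d u\<close>, and a change of the resampling weights; the weights
  sum to 1, so the latter only multiplies the oscillation at \<open>v\<close>.\<close>

lemma heat_bath_osc:
  assumes d: "osc_bound n f d" and x: "x \<in> spins n" and u: "u < n" and v: "v < n"
  shows "\<bar>heat_bath v f x - heat_bath v f (flip_spin u x)\<bar> \<le> (if u = v then 0 else d u + c u v * d v)"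
proof (cases "u = v")
  case True
  then show ?thesis by (simp add: heat_bath_def add.commute)
next
  case False
  let ?u = "flip_spin u" and ?v = "flip_spin v"
  define w where "w y = \<pi> y / (\<pi> y + \<pi> (?v y))" for y
  have hb: "heat_bath v f y = w y * f y + (1 - w y) * f (?v y)" if "y \<in> spins n" for y
    using denominator_pos[OF that v] by (simp add: heat_bath_def w_def divide_simps)
  have w: "0 \<le> w x" "w x \<le> 1"
    using denominator_pos[OF x v] weight_pos[OF x] weight_pos[of "?v x"] x v
    by (simp_all add: w_def less_imp_le)
  have "\<bar>heat_bath v f x - heat_bath v f (?u x)\<bar>
      = \<bar>w x * (f x - f (?u x)) + (1 - w x) * (f (?v x) - f (?u (?v x)))
        + (w x - w (?u x)) * (f (?u x) - f (?v (?u x)))\<bar>"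
    using x u by (simp add: hb flip_spin_commute[of u v] algebra_simps)
  also have "\<dots> \<le> w x * \<bar>f x - f (?u x)\<bar> + (1 - w x) * \<bar>f (?v x) - f (?u (?v x))\<bar>
        + \<bar>w x - w (?u x)\<bar> * \<bar>f (?u x) - f (?v (?u x))\<bar>"
    using w by (intro order_trans[OF abs_triangle_ineq] add_mono) (auto simp: abs_mult)
  also have "\<dots> \<le> w x * d u + (1 - w x) * d u + c u v * d v"
  proof -
    have bound: "\<bar>f y - f (flip_spin k y)\<bar> \<le> d k" if "y \<in> spins n" "k < n" for y k
      using d that by (simp add: osc_bound_def)
    have vx: "?v x \<in> spins n" and ux: "?u x \<in> spins n" using x u v by auto
    have "\<bar>w x - w (?u x)\<bar> \<le> c u v"
      using influence[OF x u v False] by (simp only: w_def)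
    then show ?thesis
      using w bound[OF x u] bound[OF vx u] bound[OF ux v] influence_nonneg[OF u v False]
      by (intro add_mono mult_left_mono mult_mono) simp_all
  qed
  finally show ?thesis using False by (simp add: algebra_simps)
qed

text \<open>Summed over all vertices, \<open>d u\<close> survives the \<open>n - 1\<close> updates
  elsewhere, and the influences on \<open>v\<close> add at most \<open>(1 - \<eta>) * d v\<close>.
  The total factor is \<open>(n - \<eta>) / n\<close>.\<close>

lemma glauber_osc:
  assumes d: "osc_bound n f d"
  shows "\<exists>d'. osc_bound n (glauber f) d' \<and> (\<Sum>u<n. d' u) \<le> (1 - \<eta> / n) * (\<Sum>u<n. d u)"
proof -
  define d' where "d' u = (\<Sum>v<n. if u = v then 0 else d u + c u v * d v) / n" for u
  have "osc_bound n (glauber f) d'"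
    unfolding osc_bound_def
  proof (intro allI impI ballI)
    fix u x assume ux: "u < n" "x \<in> spins n"
    have "\<bar>glauber f x - glauber f (flip_spin u x)\<bar>
        = \<bar>\<Sum>v<n. heat_bath v f x - heat_bath v f (flip_spin u x)\<bar> / n"
      by (simp add: glauber_def sum_subtractf diff_divide_distrib[symmetric])
    also have "\<dots> \<le> (\<Sum>v<n. if u = v then 0 else d u + c u v * d v) / n"
      using ux d by (intro divide_right_mono order_trans[OF sum_abs] sum_mono heat_bath_osc) auto
    finally show "\<bar>glauber f x - glauber f (flip_spin u x)\<bar> \<le> d' u" by (simp add: d'_def)
  qed
  moreover have "(\<Sum>u<n. d' u) \<le> (1 - \<eta> / n) * (\<Sum>u<n. d u)"
  proof -
    have nonneg: "0 \<le> d v" if "v < n" for v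
      using d that spins_nonempty[of n] unfolding osc_bound_def
      by (metis abs_ge_zero all_not_in_conv order_trans)
    have "n * (\<Sum>u<n. d' u) = (\<Sum>u<n. \<Sum>v<n. if u = v then 0 else d u + c u v * d v)"
      using n_pos by (simp add: d'_def sum_divide_distrib[symmetric])
    also have "\<dots> = (\<Sum>u<n. \<Sum>v<n. if u = v then 0 else d u)
        + (\<Sum>u<n. \<Sum>v<n. if u = v then 0 else c u v * d v)"
      unfolding sum.distrib[symmetric] by (intro sum.cong) auto
    also have "(\<Sum>u<n. \<Sum>v<n. if u = v then 0 else d u) = (\<Sum>u<n. (real n - 1) * d u)"
    proof (intro sum.cong refl)
      fix u assume "u \<in> {..<n}"
      then have "(\<Sum>v<n. if u = v then 0 else d u) = (\<Sum>v\<in>{..<n} - {u}. d u)"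
        by (intro sum.mono_neutral_cong_right) auto
      also have "\<dots> = (real n - 1) * d u"
        using \<open>u \<in> {..<n}\<close> by (simp add: of_nat_diff)
      finally show "(\<Sum>v<n. if u = v then 0 else d u) = (real n - 1) * d u" .
    qed
    also have "(\<Sum>u<n. \<Sum>v<n. if u = v then 0 else c u v * d v) \<le> (\<Sum>v<n. (1 - \<eta>) * d v)"
    proof (subst sum.swap, intro sum_mono)
      fix v assume "v \<in> {..<n}"
      then have "(\<Sum>u<n. if u = v then 0 else c u v * d v) = (\<Sum>u\<in>{..<n} - {v}. c u v) * d v"
        unfolding sum_distrib_right by (intro sum.mono_neutral_cong_right) auto
      also have "\<dots> \<le> (1 - \<eta>) * d v"
        using \<open>v \<in> {..<n}\<close> nonneg influence_sum by (intro mult_right_mono) auto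
      finally show "(\<Sum>u<n. if u = v then 0 else c u v * d v) \<le> (1 - \<eta>) * d v" .
    qed
    finally have "n * (\<Sum>u<n. d' u) \<le> (real n - 1) * (\<Sum>u<n. d u) + (1 - \<eta>) * (\<Sum>u<n. d u)"
      by (simp add: sum_distrib_left)
    then have "n * (\<Sum>u<n. d' u) \<le> (n - \<eta>) * (\<Sum>u<n. d u)"
      by (simp add: algebra_simps)
    then show ?thesis using n_pos by (simp add: field_simps)
  qed
  ultimately show ?thesis by blast
qed

text \<open>For a mean-zero \<open>f\<close>, the value \<open>f x\<close> is the average of
  \<open>f x - f y\<close> over \<open>y\<close>.\<close>

lemma abs_le_osc_of_mean_zero:
  assumes d: "osc_bound n f d" and zero: "ip (\<lambda>_. 1) f = 0" and x: "x \<in> spins n"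
  shows "\<bar>f x\<bar> \<le> (\<Sum>u<n. d u)"
proof -
  have "\<bar>f x\<bar> = \<bar>\<Sum>y\<in>spins n. \<pi> y * (f x - f y)\<bar>"
  proof -
    have "(\<Sum>y\<in>spins n. \<pi> y * (f x - f y)) = (\<Sum>y\<in>spins n. \<pi> y) * f x - ip (\<lambda>_. 1) f"
      unfolding ip_def by (simp only: right_diff_distrib sum_subtractf sum_distrib_right mult_1)
    then show ?thesis by (simp only: weight_sum zero mult_1 diff_0_right)
  qed
  also have "\<dots> \<le> (\<Sum>y\<in>spins n. \<pi> y * (\<Sum>u<n. d u))"
  proof (intro order_trans[OF sum_abs] sum_mono)
    fix y assume y: "y \<in> spins n"
    show "\<bar>\<pi> y * (f x - f y)\<bar> \<le> \<pi> y * (\<Sum>u<n. d u)"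
      using weight_pos[OF y] osc_bound_diff[OF d x y] by (simp add: abs_mult)
  qed
  also have "\<dots> = (\<Sum>u<n. d u)" by (simp only: weight_sum sum_distrib_right[symmetric] mult_1)
  finally show ?thesis .
qed

text \<open>The oscillations of the iterates decay like \<open>(1 - \<eta> / n) ^ j\<close>, and
  with mean zero they bound the norms. Self-adjointness makes the squared norms log-convex, so
  \<open>ratio_le_of_log_convex\<close> transfers the rate to a single step with no constant
  lost.\<close>

lemma glauber_contraction:
  assumes zero: "ip (\<lambda>_. 1) f = 0"
  shows "ip (glauber f) (glauber f) \<le> (1 - \<eta> / n)\<^sup>2 * ip f f"
proof -
  let ?r = "1 - \<eta> / n"
  have r: "0 \<le> ?r" using eta_le_one n_pos by (simp add: divide_le_eq)
  define g where "g j = (glauber ^^ j) f" for j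
  have g_Suc: "g (Suc j) = glauber (g j)" for j by (simp add: g_def)
  \<comment> \<open>A crude total oscillation suffices, since only the rate of decay enters the
    conclusion.\<close>
  define M where "M = (\<Sum>u<n. \<Sum>x\<in>spins n. \<bar>f x - f (flip_spin u x)\<bar>)"
  have osc: "\<exists>d. osc_bound n (g j) d \<and> (\<Sum>u<n. d u) \<le> M * ?r ^ j" for j
  proof (induction j)
    case 0
    have "osc_bound n f (\<lambda>u. \<Sum>x\<in>spins n. \<bar>f x - f (flip_spin u x)\<bar>)"
      unfolding osc_bound_def
      by (intro allI impI ballI member_le_sum[of _ _ "\<lambda>x. \<bar>f x - f (flip_spin _ x)\<bar>"])
         (auto simp: finite_spins)
    then show ?case by (auto simp: g_def M_def)
  next
    case (Suc j)
    then obtain d where d: "osc_bound n (g j) d" "(\<Sum>u<n. d u) \<le> M * ?r ^ j" by blast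
    from glauber_osc[OF d(1)] obtain d' where
      d': "osc_bound n (glauber (g j)) d'" "(\<Sum>u<n. d' u) \<le> ?r * (\<Sum>u<n. d u)" by blast
    from d'(2) have "(\<Sum>u<n. d' u) \<le> ?r * (M * ?r ^ j)"
      using mult_left_mono[OF d(2) r] by linarith
    then have "(\<Sum>u<n. d' u) \<le> M * ?r ^ Suc j" by (simp only: power_Suc mult.left_commute)
    with d'(1) show ?case unfolding g_Suc by blast
  qed
  have mean: "ip (\<lambda>_. 1) (g j) = 0" for j
  proof (induction j)
    case 0
    show ?case using zero by (simp add: g_def)
  next
    case (Suc j)
    then show ?case by (simp only: g_Suc ip_one_glauber)
  qed
  have bound: "ip (g j) (g j) \<le> M\<^sup>2 * (?r\<^sup>2) ^ j" for j
  proof -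
    obtain d where d: "osc_bound n (g j) d" "(\<Sum>u<n. d u) \<le> M * ?r ^ j" using osc by blast
    have "ip (g j) (g j) \<le> (\<Sum>x\<in>spins n. \<pi> x * (M * ?r ^ j)\<^sup>2)"
      unfolding ip_def
    proof (intro sum_mono mult_left_mono)
      fix x assume x: "x \<in> spins n"
      have "\<bar>g j x\<bar> \<le> M * ?r ^ j"
        using abs_le_osc_of_mean_zero[OF d(1) mean x] d(2) by linarith
      then show "g j x * g j x \<le> (M * ?r ^ j)\<^sup>2"
        by (metis abs_ge_zero power2_abs power2_eq_square power_mono)
      show "0 \<le> \<pi> x" using weight_pos[OF x] by simp
    qed
    also have "\<dots> = (M * ?r ^ j)\<^sup>2" by (simp only: weight_sum sum_distrib_right[symmetric] mult_1)
    also have "\<dots> = M\<^sup>2 * (?r\<^sup>2) ^ j"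
      by (simp only: power_mult_distrib power_mult[symmetric] mult.commute[of 2 j])
    finally show ?thesis .
  qed
  have "ip (g 1) (g 1) \<le> ?r\<^sup>2 * ip (g 0) (g 0)"
  proof (rule ratio_le_of_log_convex[of "\<lambda>j. ip (g j) (g j)"])
    show "(ip (g (Suc j)) (g (Suc j)))\<^sup>2 \<le> ip (g j) (g j) * ip (g (Suc (Suc j))) (g (Suc (Suc j)))" for j
    proof -
      \<comment> \<open>Moving one \<open>glauber\<close> across the inner product prepares
        Cauchy-Schwarz between the two neighbouring iterates.\<close>
      have "ip (g (Suc j)) (g (Suc j)) = ip (g j) (g (Suc (Suc j)))"
        unfolding g_Suc by (rule ip_glauber[symmetric])
      then show ?thesis using ip_Cauchy_Schwarz[of "g j" "g (Suc (Suc j))"] by simp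
    qed
    show "ip (g j) (g j) \<le> M\<^sup>2 * (?r\<^sup>2) ^ j" for j by (rule bound)
    show "0 \<le> ip (g j) (g j)" for j by (rule ip_nonneg)
    show "0 \<le> ?r\<^sup>2" by (rule zero_le_power2)
  qed
  then show ?thesis by (simp add: g_def)
qed

text \<open>One random update has gap \<open>\<eta> / n\<close>. Multiplying by \<open>n\<close>
  turns the average over vertices into a sum of single-site gaps, to which
  \<open>ip_heat_bath_gap\<close> applies.\<close>

theorem poincare:
  assumes zero: "(\<Sum>x\<in>spins n. \<pi> x * f x) = 0"
  shows "\<eta> * (\<Sum>x\<in>spins n. \<pi> x * (f x)\<^sup>2)
    \<le> (\<Sum>v<n. \<Sum>x\<in>spins n. \<pi> x * (f x - f (flip_spin v x))\<^sup>2) / 4"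
proof -
  have zero': "ip (\<lambda>_. 1) f = 0" using zero by (simp add: ip_def)
  have "ip f (glauber f) \<le> (1 - \<eta> / n) * ip f f"
  proof (rule power2_le_imp_le)
    have "(ip f (glauber f))\<^sup>2 \<le> ip f f * ip (glauber f) (glauber f)" by (rule ip_Cauchy_Schwarz)
    also have "\<dots> \<le> ip f f * ((1 - \<eta> / n)\<^sup>2 * ip f f)"
      by (intro mult_left_mono glauber_contraction zero' ip_nonneg)
    finally show "(ip f (glauber f))\<^sup>2 \<le> ((1 - \<eta> / n) * ip f f)\<^sup>2"
      by (simp add: power2_eq_square algebra_simps)
    show "0 \<le> (1 - \<eta> / n) * ip f f"
      using eta_le_one n_pos ip_nonneg by (intro mult_nonneg_nonneg) (auto simp: divide_le_eq)
  qed
  then have "\<eta> * ip f f \<le> n * (ip f f - ip f (glauber f))"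
    using n_pos by (simp add: field_simps)
  also have "\<dots> = (\<Sum>v<n. ip f f - ip f (heat_bath v f))"
    using n_pos by (simp add: ip_glauber_right sum_subtractf right_diff_distrib)
  also have "\<dots> \<le> (\<Sum>v<n. (\<Sum>x\<in>spins n. \<pi> x * (f x - f (flip_spin v x))\<^sup>2) / 4)"
    by (intro sum_mono ip_heat_bath_gap) auto
  finally show ?thesis by (simp add: ip_def power2_eq_square sum_divide_distrib)
qed

end

section \<open>Ising models at high temperature\<close>

definition quadratic_form :: "nat \<Rightarrow> (nat \<Rightarrow> nat \<Rightarrow> real) \<Rightarrow> (nat \<Rightarrow> real) \<Rightarrow> real" where
  "quadratic_form n a x = (\<Sum>u<n. \<Sum>v<n. a u v * (x u * x v))"

text \<open>Only terms with exactly one index equal to \<open>k\<close> change sign; the diagonal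
  term at \<open>k\<close> cancels.\<close>

lemma quadratic_form_flip:
  assumes k: "k < n"
  shows "quadratic_form n a x - quadratic_form n a (flip_spin k x)
    = 2 * x k * (\<Sum>u\<in>{..<n} - {k}. (a u k + a k u) * x u)"
proof -
  let ?y = "flip_spin k x"
  have inner: "(\<Sum>v<n. a u v * (x u * x v) - a u v * (?y u * ?y v))
      = (if u = k then \<Sum>v\<in>{..<n} - {k}. 2 * (a k v * (x k * x v)) else 2 * (a u k * (x u * x k)))" for u
  proof (cases "u = k")
    case True
    then have "(\<Sum>v<n. a u v * (x u * x v) - a u v * (?y u * ?y v))
        = (\<Sum>v\<in>{..<n} - {k}. 2 * (a k v * (x k * x v)))"
      by (intro sum.mono_neutral_cong_right) (auto simp: flip_spin_def)
    then show ?thesis using True by simp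
  next
    case False
    then have "(\<Sum>v<n. a u v * (x u * x v) - a u v * (?y u * ?y v))
        = (\<Sum>v\<in>{k}. 2 * (a u k * (x u * x k)))"
      using k by (intro sum.mono_neutral_cong_right) (auto simp: flip_spin_def)
    then show ?thesis using False by simp
  qed
  have "quadratic_form n a x - quadratic_form n a ?y
      = (\<Sum>u<n. \<Sum>v<n. a u v * (x u * x v) - a u v * (?y u * ?y v))"
    by (simp add: quadratic_form_def sum_subtractf)
  also have "\<dots> = (\<Sum>v\<in>{..<n} - {k}. 2 * (a k v * (x k * x v)))
      + (\<Sum>u\<in>{..<n} - {k}. 2 * (a u k * (x u * x k)))"
    unfolding inner using k by (subst sum.remove[of _ k]) (auto intro!: sum.cong)
  also have "\<dots> = 2 * x k * (\<Sum>u\<in>{..<n} - {k}. (a u k + a k u) * x u)"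
    unfolding sum.distrib[symmetric] sum_distrib_left
    by (intro sum.cong) (auto simp: algebra_simps)
  finally show ?thesis .
qed

section \<open>Conditional spin distributions of an Ising model\<close>

lemma sum_lower_triangle:
  fixes a :: "nat \<Rightarrow> nat \<Rightarrow> real"
  assumes "\<And>u v. u < n \<Longrightarrow> v < n \<Longrightarrow> a u v = a v u" "\<And>v. v < n \<Longrightarrow> a v v = 0"
  shows "2 * (\<Sum>v<n. \<Sum>u<v. a u v) = (\<Sum>u<n. \<Sum>v<n. a u v)"
  using assms
proof (induction n)
  case (Suc n)
  have "(\<Sum>v<n. a n v) = (\<Sum>u<n. a u n)"
    using Suc.prems by (intro sum.cong) auto
  moreover have "2 * (\<Sum>v<n. \<Sum>u<v. a u v) = (\<Sum>u<n. \<Sum>v<n. a u v)"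
    using Suc by auto
  ultimately show ?case
    using Suc.prems(2)[of n] by (simp add: sum.distrib distrib_left)
qed simp

text \<open>Every pair is counted once in the exponent, so the interaction is half of
  \<open>quadratic_form n J\<close>. The flip reverses the product of \<open>x k\<close> with its
  local field.\<close>

lemma ising_weight_flip:
  assumes params: "ising_params n h J" and k: "k < n"
  shows "ising_weight n h J (flip_spin k x)
    = ising_weight n h J x * exp (- 2 * (x k * (h k + (\<Sum>u\<in>{..<n} - {k}. J u k * x u))))"
proof -
  let ?y = "flip_spin k x"
  have quad: "2 * (\<Sum>v<n. \<Sum>u<v. J u v * z u * z v) = quadratic_form n J z" for z :: "nat \<Rightarrow> real"
    using params unfolding quadratic_form_def ising_params_def
    by (subst sum_lower_triangle) (auto simp: ac_simps)
  have "(\<Sum>u\<in>{..<n} - {k}. (J u k + J k u) * x u) = (\<Sum>u\<in>{..<n} - {k}. 2 * (J u k * x u))"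
    using params k by (intro sum.cong) (auto simp: ising_params_def)
  also have "\<dots> = 2 * (\<Sum>u\<in>{..<n} - {k}. J u k * x u)"
    by (rule sum_distrib_left[symmetric])
  finally have "(\<Sum>v<n. \<Sum>u<v. J u v * ?y u * ?y v) = (\<Sum>v<n. \<Sum>u<v. J u v * x u * x v)
      - 2 * (x k * (\<Sum>u\<in>{..<n} - {k}. J u k * x u))"
    using quadratic_form_flip[OF k, of J x] quad[of x] quad[of ?y] by simp
  moreover have "(\<Sum>v<n. h v * ?y v) = (\<Sum>v<n. h v * x v) - 2 * (h k * x k)"
    using k by (simp add: sum.remove[of "{..<n}" k] flip_spin_def)
  ultimately show ?thesis
    by (simp add: ising_weight_def exp_add[symmetric] algebra_simps)
qed

text \<open>For fixed \<open>r\<close> the difference is largest at \<open>s = 0\<close>, where it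
  equals \<open>tanh \<bar>r\<bar>\<close>.\<close>

lemma abs_sigmoid_diff_le_tanh:
  fixes s r :: real
  shows "\<bar>1 / (1 + exp (- 2 * (s + r))) - 1 / (1 + exp (- 2 * (s - r)))\<bar> \<le> tanh \<bar>r\<bar>"
proof -
  have main: "\<bar>1 / (1 + exp (- 2 * (s + r))) - 1 / (1 + exp (- 2 * (s - r)))\<bar> \<le> tanh r"
    if r: "0 \<le> r" for r
  proof -
    define a q where "a = exp (- 2 * s)" and "q = exp (- 2 * r)"
    have a: "0 < a" and q: "0 < q" "q \<le> 1" using r by (auto simp: a_def q_def)
    have e: "exp (- 2 * (s + r)) = a * q" "exp (- 2 * (s - r)) = a / q"
      by (simp_all add: a_def q_def exp_add[symmetric] exp_diff[symmetric] algebra_simps)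
    have pos: "0 < (1 + a * q) * (q + a)" "0 < 1 + a * q" "0 < q + a" "0 < 1 + q"
      using a q by (auto intro!: mult_pos_pos add_pos_pos)
    have "1 / (1 + a * q) - 1 / (1 + a / q) = a * (1 - q) * (1 + q) / ((1 + a * q) * (q + a))"
    proof -
      have "1 / (1 + a / q) = q / (q + a)" using a q by (simp add: field_simps)
      then have "1 / (1 + a * q) - 1 / (1 + a / q) = (1 * (q + a) - q * (1 + a * q)) / ((1 + a * q) * (q + a))"
        using pos by (simp only: diff_frac_eq[OF less_imp_neq[THEN not_sym, OF pos(2)] less_imp_neq[THEN not_sym, OF pos(3)]])
      then show ?thesis by (simp add: algebra_simps)
    qed
    moreover have "0 \<le> a * (1 - q) * (1 + q) / ((1 + a * q) * (q + a))"
      using a q pos by simp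
    moreover have "a * (1 - q) * (1 + q) / ((1 + a * q) * (q + a)) \<le> (1 - q) / (1 + q)"
    proof -
      \<comment> \<open>This is the exact gap in the next inequality; it vanishes only for
        \<open>a = 1\<close>, that is, \<open>s = 0\<close>.\<close>
      have "0 \<le> q * (1 - a)\<^sup>2" using q by simp
      then have "a * (1 + q) * (1 + q) \<le> (1 + a * q) * (q + a)"
        by (simp add: power2_eq_square algebra_simps)
      then have "(1 - q) * (a * (1 + q) * (1 + q)) \<le> (1 - q) * ((1 + a * q) * (q + a))"
        using q by (intro mult_left_mono) auto
      then show ?thesis
        using pos by (simp add: pos_divide_le_eq pos_le_divide_eq mult.commute mult.left_commute)
    qed
    ultimately show ?thesis
      unfolding e tanh_real_altdef q_def[symmetric] by linarith
  qed
  show ?thesis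
  proof (cases "0 \<le> r")
    case True
    then show ?thesis using main[OF True] by simp
  next
    case False
    then show ?thesis using main[of "- r"] by (simp add: abs_minus_commute)
  qed
qed

text \<open>The conditional probability of a spin is a sigmoid of its local field, and a flip at
  \<open>u\<close> shifts the field at \<open>v\<close> by \<open>2 * (J u v * x u)\<close>.\<close>

lemma ising_dobrushin:
  assumes n: "0 < n" and params: "ising_params n h J" and temp: "high_temperature \<eta> n J"
    and eta: "0 < \<eta>"
  shows "dobrushin n (pmf (ising n h J)) (\<lambda>u v. tanh \<bar>J u v\<bar>) \<eta>"
proof
  let ?Z = "ising_partition n h J"
  show "0 < n" "0 < \<eta>" by fact+
  show "0 < pmf (ising n h J) x" if "x \<in> spins n" for x
    using that by (simp add: pmf_positive_iff set_pmf_ising)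
  show "(\<Sum>x\<in>spins n. pmf (ising n h J) x) = 1"
    by (rule sum_pmf_eq_1) (auto simp: finite_spins set_pmf_ising)
  show "(\<Sum>u\<in>{..<n} - {v}. tanh \<bar>J u v\<bar>) \<le> 1 - \<eta>" if "v < n" for v
    using temp that by (simp add: high_temperature_def)
  fix x u v assume x: "x \<in> spins n" and u: "u < n" and v: "v < n" and uv: "u \<noteq> v"
  define L where "L y = h v + (\<Sum>u\<in>{..<n} - {v}. J u v * y u)" for y :: "nat \<Rightarrow> real"
  have sigmoid: "pmf (ising n h J) y / (pmf (ising n h J) y + pmf (ising n h J) (flip_spin v y))
      = 1 / (1 + exp (- 2 * (y v * L y)))" if y: "y \<in> spins n" for y
  proof -
    have pos: "0 < ising_weight n h J y" by (simp add: ising_weight_def)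
    have "pmf (ising n h J) y + pmf (ising n h J) (flip_spin v y)
        = pmf (ising n h J) y * (1 + exp (- 2 * (y v * L y)))"
      using y v by (simp add: pmf_ising ising_weight_flip[OF params v] L_def distrib_left)
    moreover have "0 < pmf (ising n h J) y"
      using y by (simp add: pmf_positive_iff set_pmf_ising)
    ultimately show ?thesis by simp
  qed
  let ?y = "flip_spin u x"
  have L: "L ?y = L x - 2 * (J u v * x u)"
    using u uv by (simp add: L_def flip_spin_def sum.remove[of "{..<n} - {v}" u])
  have y: "?y v = x v" using uv by (simp add: flip_spin_def)
  \<comment> \<open>The midpoint of the two sigmoid arguments plays the role of \<open>s\<close>,
    half their difference that of \<open>r\<close>.\<close>
  have "x v * L x = x v * (L x - J u v * x u) + x v * (J u v * x u)"
    "?y v * L ?y = x v * (L x - J u v * x u) - x v * (J u v * x u)"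
    unfolding L y by (simp_all add: algebra_simps)
  moreover have "\<bar>x v * (J u v * x u)\<bar> = \<bar>J u v\<bar>"
    using spins_cases[OF x u] spins_cases[OF x v] by auto
  moreover have "?y \<in> spins n" using x u by simp
  ultimately show "\<bar>pmf (ising n h J) x / (pmf (ising n h J) x + pmf (ising n h J) (flip_spin v x))
      - pmf (ising n h J) ?y / (pmf (ising n h J) ?y + pmf (ising n h J) (flip_spin v ?y))\<bar>
      \<le> tanh \<bar>J u v\<bar>"
    using abs_sigmoid_diff_le_tanh[of "x v * (L x - J u v * x u)" "x v * (J u v * x u)"]
    by (simp only: sigmoid x)
qed

text \<open>Centered spins make linear forms centered, so the Poincare inequality bounds their
  second moments. The flip differences of quadratic forms are, up to sign, twice such linear
  forms.\<close>

locale centered_dobrushin = dobrushin +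
  assumes spin_mean: "v < n \<Longrightarrow> (\<Sum>x\<in>spins n. \<pi> x * x v) = 0"
begin

section \<open>Variances of linear and quadratic forms\<close>

definition mean :: "((nat \<Rightarrow> real) \<Rightarrow> real) \<Rightarrow> real" where
  "mean f = (\<Sum>x\<in>spins n. \<pi> x * f x)"

lemma mean_cong: "(\<And>x. x \<in> spins n \<Longrightarrow> f x = g x) \<Longrightarrow> mean f = mean g"
  by (simp add: mean_def)

lemma mean_sum: "mean (\<lambda>x. \<Sum>i\<in>I. f i x) = (\<Sum>i\<in>I. mean (f i))"
  unfolding mean_def sum_distrib_left by (rule sum.swap)

lemma mean_mult: "mean (\<lambda>x. a * f x) = a * mean f"
  by (simp add: mean_def sum_distrib_left ac_simps)

lemma mean_linear_zero: "mean (\<lambda>x. \<Sum>u<n. a u * x u) = 0"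
  by (simp add: mean_sum mean_mult) (simp add: mean_def spin_mean)

lemma variance_poincare:
  "\<eta> * mean (\<lambda>x. (f x - mean f)\<^sup>2) \<le> (\<Sum>v<n. mean (\<lambda>x. (f x - f (flip_spin v x))\<^sup>2)) / 4"
proof -
  have "(\<Sum>x\<in>spins n. \<pi> x * (f x - mean f)) = 0"
    by (simp add: right_diff_distrib sum_subtractf mean_def sum_distrib_right[symmetric] weight_sum)
  from poincare[OF this] show ?thesis by (simp add: mean_def)
qed

text \<open>A flip at \<open>v\<close> changes the form by \<open>2 * a v * x v\<close>, whose
  square is constant on spins.\<close>

lemma variance_linear: "\<eta> * mean (\<lambda>x. (\<Sum>u<n. a u * x u)\<^sup>2) \<le> (\<Sum>u<n. (a u)\<^sup>2)"
proof -
  let ?f = "\<lambda>x. \<Sum>u<n. a u * x u"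
  have "mean (\<lambda>x. (?f x - ?f (flip_spin v x))\<^sup>2) = 4 * (a v)\<^sup>2" if v: "v < n" for v
  proof -
    have "(?f x - ?f (flip_spin v x))\<^sup>2 = 4 * (a v)\<^sup>2" if x: "x \<in> spins n" for x
    proof -
      have "?f x - ?f (flip_spin v x) = 2 * a v * x v"
        using v by (simp add: sum.remove[of "{..<n}" v] flip_spin_def)
      then show ?thesis using spins_square[OF x v] by (simp add: power_mult_distrib power2_eq_square)
    qed
    then show ?thesis by (simp add: mean_def sum_distrib_right[symmetric] weight_sum)
  qed
  then show ?thesis
    using variance_poincare[of ?f] by (simp add: mean_linear_zero sum_distrib_left[symmetric])
qed

text \<open>The Poincare inequality reduces the variance to second moments of linear forms, and
  \<open>variance_linear\<close> bounds these; each application costs a factor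
  \<open>1 / \<eta>\<close>.\<close>

lemma variance_quadratic:
  "mean (\<lambda>x. (quadratic_form n a x - mean (quadratic_form n a))\<^sup>2)
    \<le> 4 / \<eta>\<^sup>2 * (\<Sum>u<n. \<Sum>v<n. (a u v)\<^sup>2)"
proof -
  let ?f = "quadratic_form n a"
  \<comment> \<open>\<open>b\<close> symmetrizes \<open>a\<close> and drops the diagonal, whose
    contribution is constant on spins.\<close>
  define b where "b v u = (if u = v then 0 else a u v + a v u)" for u v
  have grad: "mean (\<lambda>x. (?f x - ?f (flip_spin v x))\<^sup>2) = 4 * mean (\<lambda>x. (\<Sum>u<n. b v u * x u)\<^sup>2)"
    if v: "v < n" for v
    unfolding mean_mult[symmetric]
  proof (rule mean_cong)
    fix x assume x: "x \<in> spins n"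
    have "(\<Sum>u\<in>{..<n} - {v}. (a u v + a v u) * x u) = (\<Sum>u<n. b v u * x u)"
      by (rule sum.mono_neutral_cong_left) (auto simp: b_def)
    then show "(?f x - ?f (flip_spin v x))\<^sup>2 = 4 * (\<Sum>u<n. b v u * x u)\<^sup>2"
      using spins_square[OF x v]
      by (simp add: quadratic_form_flip[OF v] power_mult_distrib power2_eq_square)
  qed
  have "\<eta> * (\<eta> * mean (\<lambda>x. (?f x - mean ?f)\<^sup>2))
      \<le> \<eta> * ((\<Sum>v<n. mean (\<lambda>x. (?f x - ?f (flip_spin v x))\<^sup>2)) / 4)"
    using eta_pos by (intro mult_left_mono variance_poincare) auto
  also have "\<dots> = (\<Sum>v<n. \<eta> * mean (\<lambda>x. (\<Sum>u<n. b v u * x u)\<^sup>2))"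
    by (simp add: grad sum_distrib_left[symmetric])
  also have "\<dots> \<le> (\<Sum>v<n. \<Sum>u<n. (b v u)\<^sup>2)"
    by (intro sum_mono variance_linear)
  \<comment> \<open>The square of a sum of two terms is at most twice the sum of squares; the two
    transposed sums coincide, which yields the factor 4.\<close>
  also have "\<dots> \<le> (\<Sum>v<n. \<Sum>u<n. 2 * (a u v)\<^sup>2 + 2 * (a v u)\<^sup>2)"
  proof (intro sum_mono)
    fix u v
    have "0 \<le> (a u v - a v u)\<^sup>2" by simp
    then show "(b v u)\<^sup>2 \<le> 2 * (a u v)\<^sup>2 + 2 * (a v u)\<^sup>2"
      by (simp add: b_def power2_eq_square algebra_simps)
  qed
  also have "\<dots> = 4 * (\<Sum>u<n. \<Sum>v<n. (a u v)\<^sup>2)"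
    unfolding sum.distrib by (subst sum.swap) (simp add: sum_distrib_left[symmetric])
  finally show ?thesis
    using eta_pos by (simp add: field_simps power2_eq_square)
qed

text \<open>The spin \<open>x v\<close> is correlated with \<open>M = \<Sum>\<^sub>u \<mu>\<^sub>u\<^sub>v x\<^sub>u\<close> by \<open>S = \<Sum>\<^sub>u \<mu>\<^sub>u\<^sub>v\<^sup>2\<close>, while \<open>M\<close> has variance at
  most \<open>S / \<eta>\<close>.\<close>

lemma sum_correlation_squares:
  assumes v: "v < n"
  shows "(\<Sum>u<n. (mean (\<lambda>x. x u * x v))\<^sup>2) \<le> 1 / \<eta>"
proof -
  define \<mu> where "\<mu> u = mean (\<lambda>x. x u * x v)" for u
  define S where "S = (\<Sum>u<n. (\<mu> u)\<^sup>2)"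
  let ?M = "\<lambda>x. \<Sum>u<n. \<mu> u * x u"
  have S: "S = mean (\<lambda>x. ?M x * x v)"
    by (simp add: S_def sum_distrib_right mean_sum mult.assoc mean_mult)
       (simp add: \<mu>_def power2_eq_square)
  have "S\<^sup>2 \<le> mean (\<lambda>x. (?M x)\<^sup>2) * mean (\<lambda>x. x v * x v)"
    using ip_Cauchy_Schwarz[of ?M "\<lambda>x. x v"] unfolding S ip_def mean_def
    by (simp add: power2_eq_square)
  also have "mean (\<lambda>x. x v * x v) = 1"
    using v weight_sum by (simp add: mean_def cong: sum.cong)
  finally have "\<eta> * S\<^sup>2 \<le> \<eta> * mean (\<lambda>x. (?M x)\<^sup>2)"
    using eta_pos by simp
  also have "\<dots> \<le> S" unfolding S_def by (rule variance_linear)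
  finally have "S * (\<eta> * S) \<le> S * 1" by (simp add: power2_eq_square ac_simps)
  moreover have "0 \<le> S" by (simp add: S_def sum_nonneg)
  ultimately have "\<eta> * S \<le> 1"
    using eta_pos by (cases "S = 0") (simp_all add: mult_le_cancel_left_pos)
  then show ?thesis using eta_pos by (simp add: S_def \<mu>_def field_simps)
qed

end

section \<open>Spin symmetry and the divergence of two models\<close>

lemma expectation_ising:
  "measure_pmf.expectation (ising n h J) f = (\<Sum>x\<in>spins n. pmf (ising n h J) x * f x)"
  by (subst integral_measure_pmf_real[of "spins n"])
     (auto simp: finite_spins set_pmf_ising mult.commute)

text \<open>Without external field the weight is invariant under negating all spins, which reverses
  \<open>x v\<close>.\<close>

lemma ising_spin_mean:
  assumes "no_external_field n h" "v < n"
  shows "(\<Sum>x\<in>spins n. pmf (ising n h J) x * x v) = 0"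
proof -
  \<comment> \<open>Coordinates from \<open>n\<close> on are kept, because members of
    \<open>spins n\<close> are extensional.\<close>
  define neg where "neg x = (\<lambda>i. if i < n then - x i else x i)" for x :: "nat \<Rightarrow> real"
  have in_spins: "neg x \<in> spins n" if "x \<in> spins n" for x
    using that by (auto simp: neg_def spins_def PiE_iff extensional_def)
  have neg_neg: "neg (neg x) = x" for x by (auto simp: neg_def)
  have "ising_weight n h J (neg x) = ising_weight n h J x" for x
  proof -
    have "(\<Sum>v<n. \<Sum>u<v. J u v * neg x u * neg x v) = (\<Sum>v<n. \<Sum>u<v. J u v * x u * x v)"
      by (intro sum.cong refl) (auto simp: neg_def)
    moreover have "(\<Sum>v<n. h v * neg x v) = (\<Sum>v<n. h v * x v)"
      using assms(1) by (simp add: no_external_field_def)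
    ultimately show ?thesis by (simp add: ising_weight_def)
  qed
  then have inv: "pmf (ising n h J) (neg x) = pmf (ising n h J) x" if "x \<in> spins n" for x
    using that in_spins by (simp add: pmf_ising)
  have "(\<Sum>x\<in>spins n. pmf (ising n h J) x * x v)
      = (\<Sum>x\<in>spins n. pmf (ising n h J) (neg x) * neg x v)"
    by (rule sum.reindex_bij_witness[of _ neg neg]) (simp_all add: in_spins neg_neg)
  also have "\<dots> = - (\<Sum>x\<in>spins n. pmf (ising n h J) x * x v)"
    using assms(2) by (simp add: inv sum_negf[symmetric]) (simp add: neg_def)
  finally show ?thesis by simp
qed

lemma ising_centered_dobrushin:
  assumes "0 < n" "ising_params n h J" "no_external_field n h" "high_temperature \<eta> n J" "0 < \<eta>"
  shows "centered_dobrushin n (pmf (ising n h J)) (\<lambda>u v. tanh \<bar>J u v\<bar>) \<eta>"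
  using ising_dobrushin[OF assms(1,2,4,5)] ising_spin_mean[OF assms(3)]
  by (simp add: centered_dobrushin_def centered_dobrushin_axioms_def)

text \<open>The log-partition functions enter only through the constant \<open>z\<close>, which
  cancels because both models have mass 1. What remains is linear in the correlations.\<close>

lemma d_SKL_ising:
  assumes "no_external_field n hp" "no_external_field n hq"
  shows "d_SKL (ising n hp Jp) (ising n hq Jq) = (\<Sum>v<n. \<Sum>u<v. (Jp u v - Jq u v) *
    (measure_pmf.expectation (ising n hp Jp) (\<lambda>x. x u * x v)
      - measure_pmf.expectation (ising n hq Jq) (\<lambda>x. x u * x v)))"
proof -
  let ?p = "ising n hp Jp" and ?q = "ising n hq Jq"
  define H where "H J x = (\<Sum>v<n. \<Sum>u<v. J u v * (x u * x v))" for J and x :: "nat \<Rightarrow> real"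
  define z where "z = ln (ising_partition n hq Jq) - ln (ising_partition n hp Jp)"
  have log_pmf: "ln (pmf (ising n h J) x) = H J x - ln (ising_partition n h J)"
    if "x \<in> spins n" "no_external_field n h" for x h J
    using that ising_partition_pos[of n h J]
    by (simp add: pmf_ising ln_div ising_weight_def no_external_field_def H_def mult.assoc)
  have pos: "0 < pmf ?p x" "0 < pmf ?q x" if "x \<in> spins n" for x
    using that by (simp_all add: pmf_positive_iff set_pmf_ising)
  have sum1: "(\<Sum>x\<in>spins n. pmf (ising n h J) x) = 1" for h J
    by (rule sum_pmf_eq_1) (auto simp: finite_spins set_pmf_ising)
  have "d_SKL ?p ?q = (\<Sum>x\<in>spins n. pmf ?p x * ln (pmf ?p x / pmf ?q x)
      + pmf ?q x * ln (pmf ?q x / pmf ?p x))"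
    unfolding d_SKL_def by (simp add: d_KL_finite set_pmf_ising finite_spins sum.distrib)
  also have "\<dots> = (\<Sum>x\<in>spins n. (pmf ?p x - pmf ?q x) * (H Jp x - H Jq x) + pmf ?p x * z - pmf ?q x * z)"
  proof (intro sum.cong refl)
    fix x assume x: "x \<in> spins n"
    show "pmf ?p x * ln (pmf ?p x / pmf ?q x) + pmf ?q x * ln (pmf ?q x / pmf ?p x)
        = (pmf ?p x - pmf ?q x) * (H Jp x - H Jq x) + pmf ?p x * z - pmf ?q x * z"
      using pos[OF x] by (simp add: ln_div log_pmf x assms z_def algebra_simps)
  qed
  also have "\<dots> = (\<Sum>x\<in>spins n. (pmf ?p x - pmf ?q x) * (H Jp x - H Jq x))"
    by (simp add: sum.distrib sum_subtractf sum_distrib_right[symmetric] sum1)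
  also have "\<dots> = (\<Sum>x\<in>spins n. \<Sum>v<n. \<Sum>u<v.
      (Jp u v - Jq u v) * (pmf ?p x * (x u * x v) - pmf ?q x * (x u * x v)))"
  proof (intro sum.cong refl)
    fix x
    have "H Jp x - H Jq x = (\<Sum>v<n. \<Sum>u<v. (Jp u v - Jq u v) * (x u * x v))"
      by (simp add: H_def sum_subtractf[symmetric] left_diff_distrib)
    then show "(pmf ?p x - pmf ?q x) * (H Jp x - H Jq x) = (\<Sum>v<n. \<Sum>u<v.
      (Jp u v - Jq u v) * (pmf ?p x * (x u * x v) - pmf ?q x * (x u * x v)))"
      unfolding sum_distrib_left by (simp add: sum_distrib_left algebra_simps)
  qed
  also have "\<dots> = (\<Sum>v<n. \<Sum>u<v. \<Sum>x\<in>spins n.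
      (Jp u v - Jq u v) * (pmf ?p x * (x u * x v) - pmf ?q x * (x u * x v)))"
    by (subst sum.swap) (intro sum.cong refl sum.swap)
  finally show ?thesis
    by (simp add: expectation_ising sum_distrib_left[symmetric] sum_subtractf)
qed

section \<open>Moments of the split-sample statistic\<close>

lemma expectation_pair_pmf_finite:
  fixes f :: "'a \<times> 'b \<Rightarrow> real"
  assumes "finite (set_pmf p)" "finite (set_pmf q)"
  shows "measure_pmf.expectation (pair_pmf p q) f
    = measure_pmf.expectation p (\<lambda>a. measure_pmf.expectation q (\<lambda>b. f (a, b)))"
proof -
  have "measure_pmf.expectation (pair_pmf p q) f
      = (\<Sum>z\<in>set_pmf p \<times> set_pmf q. f z * pmf (pair_pmf p q) z)"
    using assms by (intro integral_measure_pmf_real) auto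
  also have "\<dots> = (\<Sum>a\<in>set_pmf p. (\<Sum>b\<in>set_pmf q. f (a, b) * pmf q b) * pmf p a)"
    unfolding sum_distrib_right sum.cartesian_product
    by (intro sum.cong) (auto simp: pmf_pair)
  also have "\<dots> = (\<Sum>a\<in>set_pmf p. measure_pmf.expectation q (\<lambda>b. f (a, b)) * pmf p a)"
    using assms by (subst integral_measure_pmf_real[of "set_pmf q"]) auto
  also have "\<dots> = measure_pmf.expectation p (\<lambda>a. measure_pmf.expectation q (\<lambda>b. f (a, b)))"
    using assms by (subst integral_measure_pmf_real[of "set_pmf p"]) auto
  finally show ?thesis .
qed

lemma finite_set_Pi_pmf:
  "finite I \<Longrightarrow> finite (set_pmf p) \<Longrightarrow> finite (set_pmf (Pi_pmf I d (\<lambda>_. p)))"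
  by (simp add: set_Pi_pmf finite_PiE_dflt)

lemma expectation_Pi_pmf_union:
  fixes f :: "('i \<Rightarrow> 'a) \<Rightarrow> real"
  assumes "finite I" "finite J" "I \<inter> J = {}" "finite (set_pmf p)"
  shows "measure_pmf.expectation (Pi_pmf (I \<union> J) d (\<lambda>_. p)) f
    = measure_pmf.expectation (Pi_pmf I d (\<lambda>_. p)) (\<lambda>X.
        measure_pmf.expectation (Pi_pmf J d (\<lambda>_. p)) (\<lambda>Y. f (\<lambda>i. if i \<in> I then X i else Y i)))"
  using assms
  by (simp add: Pi_pmf_union expectation_pair_pmf_finite finite_set_Pi_pmf case_prod_unfold cong: if_cong)

text \<open>Serves to ignore samples that a statistic never reads, such as the last one when
  \<open>m\<close> is odd.\<close>

lemma expectation_Pi_pmf_restrict: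
  fixes f :: "('i \<Rightarrow> 'a) \<Rightarrow> real"
  assumes "finite A" "I \<subseteq> A" "\<And>X. f (\<lambda>i. if i \<in> I then X i else d) = f X"
  shows "measure_pmf.expectation (Pi_pmf A d p) f = measure_pmf.expectation (Pi_pmf I d p) f"
  using assms by (simp add: Pi_pmf_subset[OF assms(1,2)])

lemma expectation_sum_iid_Pi_pmf:
  fixes g :: "'a \<Rightarrow> real"
  assumes p: "finite (set_pmf p)" and I: "finite I"
  shows "measure_pmf.expectation (Pi_pmf I d (\<lambda>_. p)) (\<lambda>X. \<Sum>i\<in>I. g (X i))
    = card I * measure_pmf.expectation p g"
proof -
  have "measure_pmf.expectation (Pi_pmf I d (\<lambda>_. p)) (\<lambda>X. g (X i)) = measure_pmf.expectation p g"
    if "i \<in> I" for i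
  proof -
    have "measure_pmf.expectation (Pi_pmf I d (\<lambda>_. p)) (\<lambda>X. g (X i))
        = measure_pmf.expectation (map_pmf (\<lambda>X. X i) (Pi_pmf I d (\<lambda>_. p))) g"
      by simp
    then show ?thesis using that I by (simp only: Pi_pmf_component if_True)
  qed
  moreover have "integrable (Pi_pmf I d (\<lambda>_. p)) (\<lambda>X. g (X i))" for i
    by (intro integrable_measure_pmf_finite finite_set_Pi_pmf I p)
  ultimately show ?thesis by simp
qed

text \<open>Induction over the samples: the cross term with a new independent sample factors into
  means, so variances add.\<close>

lemma second_moment_sum_Pi_pmf:
  fixes g :: "'a \<Rightarrow> real" and \<mu> :: real
  assumes p: "finite (set_pmf p)" and I: "finite I"
  defines "\<mu> \<equiv> measure_pmf.expectation p g"
  shows "measure_pmf.expectation (Pi_pmf I d (\<lambda>_. p)) (\<lambda>X. (\<Sum>i\<in>I. g (X i))\<^sup>2)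
    = card I * measure_pmf.expectation p (\<lambda>x. (g x - \<mu>)\<^sup>2) + (card I * \<mu>)\<^sup>2"
  using I
proof (induction rule: finite_induct)
  case (insert k I)
  let ?P = "Pi_pmf I d (\<lambda>_. p)"
  let ?S = "\<lambda>X. \<Sum>i\<in>I. g (X i)"
  define V where "V = measure_pmf.expectation p (\<lambda>x. (g x - \<mu>)\<^sup>2)"
  have int_p [simp]: "integrable p f" for f :: "'a \<Rightarrow> real"
    using p by (rule integrable_measure_pmf_finite)
  have int_P [simp]: "integrable ?P f" for f :: "('b \<Rightarrow> 'a) \<Rightarrow> real"
    by (intro integrable_measure_pmf_finite finite_set_Pi_pmf insert p)
  have V: "measure_pmf.expectation p (\<lambda>x. (g x)\<^sup>2) = V + \<mu>\<^sup>2"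
    unfolding V_def power2_diff by (simp add: \<mu>_def power2_eq_square)
  have mean_S: "measure_pmf.expectation ?P ?S = card I * \<mu>"
    using expectation_sum_iid_Pi_pmf[OF p insert.hyps(1), of d g] by (simp add: \<mu>_def)
  have "measure_pmf.expectation (Pi_pmf (insert k I) d (\<lambda>_. p)) (\<lambda>X. (\<Sum>i\<in>insert k I. g (X i))\<^sup>2)
      = measure_pmf.expectation (pair_pmf p ?P) (\<lambda>(y, X). (g y + ?S X)\<^sup>2)"
  proof -
    have "(\<Sum>i\<in>I. g ((X(k := y)) i)) = ?S X" for X y
      using insert.hyps by (intro sum.cong) auto
    then show ?thesis
      using insert.hyps by (simp add: Pi_pmf_insert case_prod_unfold del: fun_upd_apply) simp
  qed
  also have "\<dots> = measure_pmf.expectation p (\<lambda>y. measure_pmf.expectation ?P (\<lambda>X. (g y + ?S X)\<^sup>2))"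
    by (simp add: expectation_pair_pmf_finite p finite_set_Pi_pmf insert.hyps)
  also have "\<dots> = measure_pmf.expectation p
      (\<lambda>y. (g y)\<^sup>2 + 2 * (card I * \<mu>) * g y + measure_pmf.expectation ?P (\<lambda>X. (?S X)\<^sup>2))"
    by (simp add: power2_sum mean_S ac_simps)
  also have "\<dots> = V + \<mu>\<^sup>2 + 2 * (card I * \<mu>) * \<mu> + (card I * V + (card I * \<mu>)\<^sup>2)"
    using insert.IH by (simp add: V V_def[symmetric]) (simp add: \<mu>_def)
  also have "\<dots> = card (insert k I) * V + (card (insert k I) * \<mu>)\<^sup>2"
    using insert.hyps by (simp add: power2_eq_square algebra_simps)
  finally show ?case by (simp add: V_def)
qed simp

text \<open>\<open>var\<close> says that the covariance operator of \<open>W\<close> has norm at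
  most \<open>K\<close>. The blocks are independent, so \<open>Z\<close> has mean proportional to
  \<open>D\<close>, and its second moment is bounded by treating \<open>Z\<close> as a linear
  statistic of one block at a time.\<close>

lemma split_statistic_moments:
  fixes W :: "'a \<Rightarrow> 't \<Rightarrow> real" and \<Delta> :: "'t \<Rightarrow> real" and D K :: real
  assumes p: "finite (set_pmf p)" and T: "finite T"
    and I: "finite I" "card I = h" and J: "finite J" "card J = h" and disj: "I \<inter> J = {}"
  defines "\<Delta> \<equiv> \<lambda>t. measure_pmf.expectation p (\<lambda>x. W x t)"
  defines "D \<equiv> \<Sum>t\<in>T. (\<Delta> t)\<^sup>2"
  defines "Z \<equiv> \<lambda>X. \<Sum>t\<in>T. (\<Sum>i\<in>I. W (X i) t) * (\<Sum>j\<in>J. W (X j) t)"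
  assumes var: "\<And>b. measure_pmf.expectation p (\<lambda>x. (\<Sum>t\<in>T. b t * (W x t - \<Delta> t))\<^sup>2) \<le> K * (\<Sum>t\<in>T. (b t)\<^sup>2)"
  shows "measure_pmf.expectation (Pi_pmf (I \<union> J) d (\<lambda>_. p)) Z = h\<^sup>2 * D" (is "?mean")
    and "measure_pmf.expectation (Pi_pmf (I \<union> J) d (\<lambda>_. p)) (\<lambda>X. (Z X)\<^sup>2)
      \<le> (h\<^sup>2 * D)\<^sup>2 + h\<^sup>2 * K\<^sup>2 * card T + 2 * h ^ 3 * K * D" (is "?second")
proof -
  let ?I = "Pi_pmf I d (\<lambda>_. p)" and ?J = "Pi_pmf J d (\<lambda>_. p)"
  let ?A = "\<lambda>X t. \<Sum>i\<in>I. W (X i) t" and ?B = "\<lambda>Y t. \<Sum>j\<in>J. W (Y j) t"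
  have int_p [simp]: "integrable p f" for f :: "'a \<Rightarrow> real"
    using p by (rule integrable_measure_pmf_finite)
  have int_I [simp]: "integrable ?I f" and int_J [simp]: "integrable ?J f" for f :: "_ \<Rightarrow> real"
    by (intro integrable_measure_pmf_finite finite_set_Pi_pmf I J p)+
  \<comment> \<open>Obtained by testing \<open>var\<close> on the constant vector 1. For empty
    \<open>T\<close> the sign of \<open>K\<close> is undetermined, but then the sums over
    \<open>T\<close> vanish.\<close>
  have K: "0 \<le> K" if "T \<noteq> {}"
  proof -
    have "0 \<le> K * (\<Sum>t\<in>T. 1\<^sup>2)"
      by (rule order_trans[OF _ var]) simp
    then show ?thesis using that T by (simp add: zero_le_mult_iff card_gt_0_iff)
  qed
  have Z_merge: "Z (\<lambda>i. if i \<in> I then X i else Y i) = (\<Sum>t\<in>T. ?A X t * ?B Y t)" for X Y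
  proof -
    have "(\<Sum>j\<in>J. W (if j \<in> I then X j else Y j) t) = ?B Y t" for t
      using disj by (intro sum.cong) auto
    then show ?thesis by (simp add: Z_def)
  qed
  have mean_A: "measure_pmf.expectation ?I (\<lambda>X. ?A X t) = h * \<Delta> t" for t
    using expectation_sum_iid_Pi_pmf[OF p I(1), of d "\<lambda>x. W x t"] by (simp add: \<Delta>_def I)
  have mean_B: "measure_pmf.expectation ?J (\<lambda>X. ?B X t) = h * \<Delta> t" for t
    using expectation_sum_iid_Pi_pmf[OF p J(1), of d "\<lambda>x. W x t"] by (simp add: \<Delta>_def J)
  have "measure_pmf.expectation (Pi_pmf (I \<union> J) d (\<lambda>_. p)) Z
      = measure_pmf.expectation ?I (\<lambda>X. \<Sum>t\<in>T. ?A X t * (h * \<Delta> t))"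
    by (simp add: expectation_Pi_pmf_union I J disj p Z_merge mean_B)
  also have "\<dots> = (\<Sum>t\<in>T. h * \<Delta> t * (h * \<Delta> t))"
    by (simp add: mean_A)
  also have "\<dots> = h\<^sup>2 * D"
    by (simp add: D_def sum_distrib_left power2_eq_square ac_simps)
  finally show ?mean by simp
  have second: "measure_pmf.expectation (Pi_pmf L d (\<lambda>_. p)) (\<lambda>X. (\<Sum>t\<in>T. b t * (\<Sum>i\<in>L. W (X i) t))\<^sup>2)
      \<le> h * (K * (\<Sum>t\<in>T. (b t)\<^sup>2)) + h\<^sup>2 * (\<Sum>t\<in>T. b t * \<Delta> t)\<^sup>2"
    if L: "finite L" "card L = h" for L :: "'b set" and b
  proof -
    define g where "g = (\<lambda>x. \<Sum>t\<in>T. b t * W x t)"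
    have mean_g: "measure_pmf.expectation p g = (\<Sum>t\<in>T. b t * \<Delta> t)"
      by (simp add: g_def \<Delta>_def)
    have "(\<Sum>t\<in>T. b t * (\<Sum>i\<in>L. W (X i) t)) = (\<Sum>i\<in>L. g (X i))" for X
      unfolding g_def sum_distrib_left by (rule sum.swap)
    then have "measure_pmf.expectation (Pi_pmf L d (\<lambda>_. p)) (\<lambda>X. (\<Sum>t\<in>T. b t * (\<Sum>i\<in>L. W (X i) t))\<^sup>2)
        = h * measure_pmf.expectation p (\<lambda>x. (g x - measure_pmf.expectation p g)\<^sup>2)
          + (h * measure_pmf.expectation p g)\<^sup>2"
      using second_moment_sum_Pi_pmf[OF p L(1), of d g] L(2) by simp
    also have "measure_pmf.expectation p (\<lambda>x. (g x - measure_pmf.expectation p g)\<^sup>2)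
        = measure_pmf.expectation p (\<lambda>x. (\<Sum>t\<in>T. b t * (W x t - \<Delta> t))\<^sup>2)"
      unfolding mean_g by (simp add: g_def right_diff_distrib sum_subtractf)
    finally show ?thesis
      using mult_left_mono[OF var[of b], of h] by (simp add: mean_g power_mult_distrib)
  qed
  \<comment> \<open>The indicator of \<open>t\<close> as coefficient vector isolates one
    coordinate.\<close>
  have A_square: "measure_pmf.expectation ?I (\<lambda>X. (?A X t)\<^sup>2) \<le> h * K + h\<^sup>2 * (\<Delta> t)\<^sup>2"
    if "t \<in> T" for t
    using second[OF I, of "\<lambda>s. if s = t then 1 else 0"] that T
    by (simp add: if_distrib[of "\<lambda>b. b * _"] if_distrib[of "\<lambda>b. b\<^sup>2"] cong: if_cong)
  have "measure_pmf.expectation (Pi_pmf (I \<union> J) d (\<lambda>_. p)) (\<lambda>X. (Z X)\<^sup>2)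
      = measure_pmf.expectation ?I (\<lambda>X. measure_pmf.expectation ?J (\<lambda>Y. (\<Sum>t\<in>T. ?A X t * ?B Y t)\<^sup>2))"
    by (simp add: expectation_Pi_pmf_union I J disj p Z_merge)
  \<comment> \<open>With the block \<open>I\<close> held fixed, \<open>Z\<close> is linear in the
    block \<open>J\<close> with coefficients \<open>?A X t\<close>.\<close>
  also have "\<dots> \<le> measure_pmf.expectation ?I (\<lambda>X. h * (K * (\<Sum>t\<in>T. (?A X t)\<^sup>2))
      + h\<^sup>2 * (\<Sum>t\<in>T. \<Delta> t * ?A X t)\<^sup>2)"
    by (intro integral_mono int_I) (use second[OF J] in \<open>simp add: mult.commute[of "\<Delta> _"]\<close>)
  also have "\<dots> = h * (K * (\<Sum>t\<in>T. measure_pmf.expectation ?I (\<lambda>X. (?A X t)\<^sup>2)))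
      + h\<^sup>2 * measure_pmf.expectation ?I (\<lambda>X. (\<Sum>t\<in>T. \<Delta> t * ?A X t)\<^sup>2)"
    by simp
  also have "\<dots> \<le> h * (K * (\<Sum>t\<in>T. h * K + h\<^sup>2 * (\<Delta> t)\<^sup>2)) + h\<^sup>2 * (h * (K * D) + h\<^sup>2 * D\<^sup>2)"
  proof -
    have "K * (\<Sum>t\<in>T. measure_pmf.expectation ?I (\<lambda>X. (?A X t)\<^sup>2)) \<le> K * (\<Sum>t\<in>T. h * K + h\<^sup>2 * (\<Delta> t)\<^sup>2)"
      using K A_square by (cases "T = {}") (auto intro!: mult_left_mono sum_mono)
    moreover have "measure_pmf.expectation ?I (\<lambda>X. (\<Sum>t\<in>T. \<Delta> t * ?A X t)\<^sup>2) \<le> h * (K * D) + h\<^sup>2 * D\<^sup>2"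
      using second[OF I, of \<Delta>] by (simp add: D_def power2_eq_square)
    ultimately show ?thesis
      by (intro add_mono[OF mult_left_mono mult_left_mono]) auto
  qed
  also have "(\<Sum>t\<in>T. h * K + h\<^sup>2 * (\<Delta> t)\<^sup>2) = card T * (h * K) + h\<^sup>2 * D"
    by (simp add: sum.distrib D_def sum_distrib_left)
  finally show ?second
    by (simp add: power2_eq_square power3_eq_cube algebra_simps)
qed

text \<open>The leading term of the second-moment bound is exactly the squared mean, so only the
  other two terms remain in the variance.\<close>

lemma split_statistic_Chebyshev:
  fixes W :: "'a \<Rightarrow> 't \<Rightarrow> real" and \<Delta> :: "'t \<Rightarrow> real" and D K :: real
  assumes p: "finite (set_pmf p)" and T: "finite T" and A: "finite A" "I \<union> J \<subseteq> A"
    and I: "finite I" "card I = h" and J: "finite J" "card J = h" and disj: "I \<inter> J = {}"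
  defines "\<Delta> \<equiv> \<lambda>t. measure_pmf.expectation p (\<lambda>x. W x t)"
  defines "D \<equiv> \<Sum>t\<in>T. (\<Delta> t)\<^sup>2"
  defines "Z \<equiv> \<lambda>X. \<Sum>t\<in>T. (\<Sum>i\<in>I. W (X i) t) * (\<Sum>j\<in>J. W (X j) t)"
  assumes var: "\<And>b. measure_pmf.expectation p (\<lambda>x. (\<Sum>t\<in>T. b t * (W x t - \<Delta> t))\<^sup>2) \<le> K * (\<Sum>t\<in>T. (b t)\<^sup>2)"
    and a: "0 < a"
  shows "measure_pmf.prob (Pi_pmf A d (\<lambda>_. p)) {X. a \<le> \<bar>Z X - h\<^sup>2 * D\<bar>}
    \<le> (h\<^sup>2 * K\<^sup>2 * card T + 2 * h ^ 3 * K * D) / a\<^sup>2"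
proof -
  let ?P = "Pi_pmf A d (\<lambda>_. p)"
  have int [simp]: "integrable ?P f" for f :: "_ \<Rightarrow> real"
    by (intro integrable_measure_pmf_finite finite_set_Pi_pmf A p)
  have "Z (\<lambda>i. if i \<in> I \<union> J then X i else d) = Z X" for X
    by (simp add: Z_def cong: sum.cong)
  then have restrict: "measure_pmf.expectation ?P (\<lambda>X. F (Z X))
      = measure_pmf.expectation (Pi_pmf (I \<union> J) d (\<lambda>_. p)) (\<lambda>X. F (Z X))" for F :: "real \<Rightarrow> real"
    by (intro expectation_Pi_pmf_restrict A) simp
  note moments = split_statistic_moments[OF p T I J disj var[unfolded \<Delta>_def], of d]
  have mean: "measure_pmf.expectation ?P Z = h\<^sup>2 * D"
    using restrict[of "\<lambda>z. z"] moments(1) by (simp add: D_def \<Delta>_def Z_def)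
  have second: "measure_pmf.expectation ?P (\<lambda>X. (Z X)\<^sup>2)
      \<le> (h\<^sup>2 * D)\<^sup>2 + h\<^sup>2 * K\<^sup>2 * card T + 2 * h ^ 3 * K * D"
    using restrict[of "\<lambda>z. z\<^sup>2"] moments(2) by (simp add: D_def \<Delta>_def Z_def)
  have "measure_pmf.prob ?P {X\<in>space ?P. a \<le> \<bar>Z X - measure_pmf.expectation ?P Z\<bar>}
      \<le> measure_pmf.variance ?P Z / a\<^sup>2"
    using a by (intro measure_pmf.Chebyshev_inequality) auto
  also have "measure_pmf.variance ?P Z = measure_pmf.expectation ?P (\<lambda>X. (Z X)\<^sup>2) - (h\<^sup>2 * D)\<^sup>2"
    by (subst measure_pmf.variance_eq) (auto simp: mean)
  also have "\<dots> / a\<^sup>2 \<le> (h\<^sup>2 * K\<^sup>2 * card T + 2 * h ^ 3 * K * D) / a\<^sup>2"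
    using second by (intro divide_right_mono) auto
  finally show ?thesis by (simp add: mean)
qed

section \<open>The tester\<close>

lemma length_matrix_list [simp]: "length (matrix_list r c M) = r * c"
  by (simp add: matrix_list_def)

lemma lookup_append_left: "k < length xs \<Longrightarrow> lookup (xs @ ys) k = lookup xs k"
  by (simp add: lookup_def nth_append)

lemma lookup_append_right: "lookup (xs @ ys) (length xs + k) = lookup ys k"
  by (simp add: lookup_def nth_append)

lemma lookup_matrix_list:
  assumes "i < r" "j < c"
  shows "lookup (matrix_list r c M) (i * c + j) = M i j"
proof -
  have "i * c + j < Suc i * c" using assms(2) by simp
  also have "\<dots> \<le> r * c" using assms(1) by (intro mult_right_mono) auto
  finally show ?thesis using assms(2) by (simp add: lookup_def matrix_list_def)
qed

lemma exec_Input: "exec xs a env = real k \<Longrightarrow> exec xs (Input a) env = lookup xs k"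
  by simp

text \<open>Induction runs over initial segments \<open>j \<le> k\<close>, since the body is only
  specified for indices below \<open>k\<close>.\<close>

lemma exec_Loop_sum:
  assumes "nat \<lfloor>exec xs N env\<rfloor> = k"
    and body: "\<And>i acc. i < k \<Longrightarrow> exec xs b (real i # acc # env) = acc + g i"
  shows "exec xs (Loop N a b) env = exec xs a env + (\<Sum>i<k. g i)"
proof -
  have "rec_nat (exec xs a env) (\<lambda>i acc. exec xs b (real i # acc # env)) j
      = exec xs a env + (\<Sum>i<j. g i)" if "j \<le> k" for j
    using that by (induction j) (simp_all add: body)
  then show ?thesis using assms(1) by simp
qed

section \<open>Construction of the program\<close>

definition vertices_prog :: prog where
  "vertices_prog = Input (Const 0)"

text \<open>The value \<open>m / 2\<close> may be fractional; as a loop bound it is rounded down to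
  \<open>m div 2\<close>.\<close>

definition half_prog :: prog where
  "half_prog = Div (Input (Const 3)) (Const 2)"

text \<open>The offset skips four scalars, the \<open>n\<close> node parameters, the
  \<open>n * n\<close> edge parameters and the \<open>n\<close> means.\<close>

definition correlation_prog :: "prog \<Rightarrow> prog \<Rightarrow> prog" where
  "correlation_prog u v = Input (Add (Add (Const 4) (Mult vertices_prog (Add (Const 2) vertices_prog)))
     (Add (Mult u vertices_prog) v))"

text \<open>The offset skips the four scalars and the whole description, of length
  \<open>2 * n * (1 + n)\<close>.\<close>

definition sample_prog :: "prog \<Rightarrow> prog \<Rightarrow> prog" where
  "sample_prog i v = Input (Add (Add (Const 4)
       (Mult (Mult (Const 2) vertices_prog) (Add (Const 1) vertices_prog)))
     (Add (Mult i vertices_prog) v))"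

text \<open>To be run with \<open>Var 0\<close> bound to \<open>v\<close> and \<open>Var 2\<close> bound to \<open>u\<close>; the loop shifts both by two.
  The argument selects the samples with even (0) or odd (1) index.\<close>

definition residual_prog :: "int \<Rightarrow> prog" where
  "residual_prog c =
     (let i = Add (Mult (Const 2) (Var 0)) (Const c)
      in Loop half_prog (Const 0)
           (Add (Var 1) (Sub (Mult (sample_prog i (Var 4)) (sample_prog i (Var 2)))
             (correlation_prog (Var 4) (Var 2)))))"

text \<open>The inner loop starts from the outer accumulator, so both loops feed one running
  sum.\<close>

definition statistic_prog :: prog where
  "statistic_prog = Loop vertices_prog (Const 0)
     (Loop vertices_prog (Var 1) (Add (Var 1) (Mult (residual_prog 0) (residual_prog 1))))"

text \<open>\<open>half_count\<close> obtains \<open>m div 2\<close> by counting iterations. The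
  comparison is multiplied out, which avoids dividing by \<open>\<beta>\<close> or \<open>n\<close>,
  both possibly zero.\<close>

definition tester_prog :: prog where
  "tester_prog =
     (let \<beta> = Input (Const 1); \<epsilon> = Input (Const 2);
          half_count = Loop half_prog (Const 0) (Add (Var 1) (Const 1))
      in IfLess (Mult (Mult \<epsilon> \<epsilon>) (Mult half_count half_count))
           (Mult (Mult (Const 8) (Mult (Mult \<beta> \<beta>) (Mult vertices_prog vertices_prog))) statistic_prog)
           (Const 0) (Const 1))"

section \<open>Evaluation of the program\<close>

definition residual_sum ::
    "(nat \<Rightarrow> nat \<Rightarrow> real) \<Rightarrow> nat set \<Rightarrow> (nat \<Rightarrow> nat \<Rightarrow> real) \<Rightarrow> nat \<Rightarrow> nat \<Rightarrow> real" where
  "residual_sum \<mu> I X u v = (\<Sum>i\<in>I. X i u * X i v - \<mu> u v)"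

definition split_statistic ::
    "nat \<Rightarrow> (nat \<Rightarrow> nat \<Rightarrow> real) \<Rightarrow> nat \<Rightarrow> (nat \<Rightarrow> nat \<Rightarrow> real) \<Rightarrow> real" where
  "split_statistic n \<mu> k X = (\<Sum>u<n. \<Sum>v<n.
     residual_sum \<mu> ((\<lambda>i. 2 * i) ` {..<k}) X u v * residual_sum \<mu> ((\<lambda>i. 2 * i + 1) ` {..<k}) X u v)"

lemma run_tester_prog:
  fixes n m :: nat and \<beta> \<epsilon> :: real and h J X
  defines "\<mu> \<equiv> \<lambda>u v. measure_pmf.expectation (ising n h J) (\<lambda>x. x u * x v)"
  shows "run tester_prog (tester_input n \<beta> \<epsilon> m (ising_description n h J) X)
    = (if \<epsilon>\<^sup>2 * (real (m div 2))\<^sup>2 < 8 * \<beta>\<^sup>2 * (real n)\<^sup>2 * split_statistic n \<mu> (m div 2) X then 0 else 1)"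
proof -
  define xs where "xs = tester_input n \<beta> \<epsilon> m (ising_description n h J) X"
  define pre where "pre = [real n, \<beta>, \<epsilon>, real m] @ map h [0..<n] @ matrix_list n n J
    @ map (\<lambda>v. measure_pmf.expectation (ising n h J) (\<lambda>x. x v)) [0..<n]"
  have xs: "xs = pre @ matrix_list n n \<mu> @ matrix_list m n X"
    by (simp add: xs_def pre_def tester_input_def ising_description_def \<mu>_def Let_def)
  have len: "length pre = 4 + n * (2 + n)" by (simp add: pre_def algebra_simps)
  have scalars: "lookup xs 0 = n" "lookup xs 1 = \<beta>" "lookup xs 2 = \<epsilon>" "lookup xs 3 = m"
    by (simp_all add: xs_def tester_input_def lookup_def numeral_2_eq_2 numeral_3_eq_3)
  have corr: "lookup xs (4 + n * (2 + n) + (u * n + v)) = \<mu> u v" if uv: "u < n" "v < n" for u v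
  proof -
    have "u * n + v < Suc u * n" using uv by simp
    also have "\<dots> \<le> n * n" using uv by (intro mult_right_mono) auto
    finally show ?thesis
      unfolding xs len[symmetric]
      by (simp add: lookup_append_right lookup_append_left lookup_matrix_list uv)
  qed
  have sample: "lookup xs (4 + 2 * n * (1 + n) + (i * n + v)) = X i v" if iv: "i < m" "v < n" for i v
  proof -
    have "4 + 2 * n * (1 + n) + (i * n + v) = length pre + (length (matrix_list n n \<mu>) + (i * n + v))"
      by (simp add: len algebra_simps)
    then show ?thesis
      unfolding xs by (simp only: lookup_append_right lookup_matrix_list iv)
  qed
  have n: "exec xs vertices_prog env = n" for env
    by (simp add: vertices_prog_def scalars)
  have loop_n: "nat \<lfloor>exec xs vertices_prog env\<rfloor> = n" for env by (simp add: n)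
  have loop_half: "nat \<lfloor>exec xs half_prog env\<rfloor> = m div 2" for env
    using floor_divide_of_nat_eq[where 'a=real, of m 2] by (simp add: half_prog_def scalars)
  have exec_corr: "exec xs (correlation_prog a b) env = \<mu> u v"
    if "exec xs a env = real u" "exec xs b env = real v" "u < n" "v < n" for a b env u v
    unfolding correlation_prog_def corr[OF that(3,4), symmetric]
    by (rule exec_Input) (simp add: that n algebra_simps)
  have exec_sample: "exec xs (sample_prog a b) env = X i v"
    if "exec xs a env = real i" "exec xs b env = real v" "i < m" "v < n" for a b env i v
    unfolding sample_prog_def sample[OF that(3,4), symmetric]
    by (rule exec_Input) (simp add: that n algebra_simps)
  have exec_residual: "exec xs (residual_prog (int c)) (real v # r # real u # env)
      = residual_sum \<mu> ((\<lambda>i. 2 * i + c) ` {..<m div 2}) X u v"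
    if "u < n" "v < n" "c \<le> 1" for u v c env r
  proof -
    have "exec xs (residual_prog (int c)) (real v # r # real u # env)
        = exec xs (Const 0) (real v # r # real u # env)
          + (\<Sum>i<m div 2. X (2 * i + c) u * X (2 * i + c) v - \<mu> u v)"
      unfolding residual_prog_def Let_def
    proof (rule exec_Loop_sum[OF loop_half])
      fix i acc assume i: "i < m div 2"
      let ?env = "real i # acc # real v # r # real u # env"
      let ?i = "Add (Mult (Const 2) (Var 0)) (Const (int c))"
      have "exec xs ?i ?env = real (2 * i + c)" by (simp add: lookup_def)
      moreover have "exec xs (Var 4) ?env = real u" "exec xs (Var 2) ?env = real v" "exec xs (Var 1) ?env = acc"
        by (simp_all add: lookup_def)
      \<comment> \<open>Both parities stay in range even for odd \<open>m\<close>, because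
        \<open>i < m div 2\<close>.\<close>
      moreover have "2 * i + c < m" using i that(3) by linarith
      ultimately show "exec xs (Add (Var 1) (Sub (Mult (sample_prog ?i (Var 4)) (sample_prog ?i (Var 2)))
             (correlation_prog (Var 4) (Var 2)))) ?env
          = acc + (X (2 * i + c) u * X (2 * i + c) v - \<mu> u v)"
        using that by (simp only: exec.simps(4-6) exec_sample exec_corr)
    qed
    then show ?thesis
      by (simp add: residual_sum_def sum.reindex inj_on_def)
  qed
  have statistic: "exec xs statistic_prog [] = split_statistic n \<mu> (m div 2) X"
  proof -
    let ?R = "\<lambda>c. residual_sum \<mu> ((\<lambda>i. 2 * i + c) ` {..<m div 2}) X"
    have "exec xs statistic_prog [] = exec xs (Const 0) [] + (\<Sum>u<n. \<Sum>v<n. ?R 0 u v * ?R 1 u v)"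
      unfolding statistic_prog_def
    proof (rule exec_Loop_sum[OF loop_n])
      fix u acc assume u: "u < n"
      have "exec xs (Loop vertices_prog (Var 1) (Add (Var 1) (Mult (residual_prog 0) (residual_prog 1)))) [real u, acc]
          = exec xs (Var 1) [real u, acc] + (\<Sum>v<n. ?R 0 u v * ?R 1 u v)"
      proof (rule exec_Loop_sum[OF loop_n])
        fix v acc' assume v: "v < n"
        show "exec xs (Add (Var 1) (Mult (residual_prog 0) (residual_prog 1))) [real v, acc', real u, acc]
            = acc' + ?R 0 u v * ?R 1 u v"
          using exec_residual[OF u v, of 0] exec_residual[OF u v, of 1] by (simp add: lookup_def)
      qed
      then show "exec xs (Loop vertices_prog (Var 1) (Add (Var 1) (Mult (residual_prog 0) (residual_prog 1)))) [real u, acc]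
          = acc + (\<Sum>v<n. ?R 0 u v * ?R 1 u v)"
        by (simp add: lookup_def)
    qed
    then show ?thesis by (simp add: split_statistic_def)
  qed
  have half: "exec xs (Loop half_prog (Const 0) (Add (Var 1) (Const 1))) [] = real (m div 2)"
    by (subst exec_Loop_sum[OF loop_half, where g = "\<lambda>_. 1"]) (simp_all add: lookup_def)
  have beta: "exec xs (Input (Const 1)) [] = \<beta>" and eps: "exec xs (Input (Const 2)) [] = \<epsilon>"
    using scalars by simp_all
  show ?thesis
    unfolding run_def xs_def[symmetric] tester_prog_def Let_def
    by (simp only: exec.simps(1,6,8) half statistic n beta eps power2_eq_square of_int_numeral of_int_0 of_int_1 mult.assoc)
qed

section \<open>Correctness\<close>

definition correlation :: "nat \<Rightarrow> (nat \<Rightarrow> real) \<Rightarrow> (nat \<Rightarrow> nat \<Rightarrow> real) \<Rightarrow> nat \<Rightarrow> nat \<Rightarrow> real" where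
  "correlation n h J u v = measure_pmf.expectation (ising n h J) (\<lambda>x. x u * x v)"

definition correlation_distance ::
    "nat \<Rightarrow> (nat \<Rightarrow> nat \<Rightarrow> real) \<Rightarrow> (nat \<Rightarrow> nat \<Rightarrow> real) \<Rightarrow> real" where
  "correlation_distance n \<mu> \<nu> = (\<Sum>u<n. \<Sum>v<n. (\<mu> u v - \<nu> u v)\<^sup>2)"

text \<open>Each column of either correlation matrix has squared norm at most
  \<open>1 / \<eta>\<close>. The bound later guarantees that a far pair comes with at least two
  samples.\<close>

lemma correlation_distance_le:
  assumes "0 < n" "0 < \<eta>" "ising_params n hp Jp" "ising_params n hq Jq"
    "no_external_field n hp" "no_external_field n hq"
    "high_temperature \<eta> n Jp" "high_temperature \<eta> n Jq"
  shows "correlation_distance n (correlation n hp Jp) (correlation n hq Jq) \<le> 4 * n / \<eta>"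
proof -
  let ?p = "correlation n hp Jp" and ?q = "correlation n hq Jq"
  interpret p: centered_dobrushin n "pmf (ising n hp Jp)" "\<lambda>u v. tanh \<bar>Jp u v\<bar>" \<eta>
    using assms by (intro ising_centered_dobrushin) auto
  interpret q: centered_dobrushin n "pmf (ising n hq Jq)" "\<lambda>u v. tanh \<bar>Jq u v\<bar>" \<eta>
    using assms by (intro ising_centered_dobrushin) auto
  have "correlation_distance n ?p ?q = (\<Sum>v<n. \<Sum>u<n. (?p u v - ?q u v)\<^sup>2)"
    unfolding correlation_distance_def by (rule sum.swap)
  also have "\<dots> \<le> (\<Sum>v<n. \<Sum>u<n. 2 * (?p u v)\<^sup>2 + 2 * (?q u v)\<^sup>2)"
  proof (intro sum_mono)
    fix u v
    have "0 \<le> (?p u v + ?q u v)\<^sup>2" by simp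
    then show "(?p u v - ?q u v)\<^sup>2 \<le> 2 * (?p u v)\<^sup>2 + 2 * (?q u v)\<^sup>2"
      by (simp add: power2_eq_square algebra_simps)
  qed
  also have "\<dots> \<le> (\<Sum>v<n. 4 / \<eta>)"
  proof (intro sum_mono)
    fix v assume "v \<in> {..<n}"
    then show "(\<Sum>u<n. 2 * (?p u v)\<^sup>2 + 2 * (?q u v)\<^sup>2) \<le> 4 / \<eta>"
      using p.sum_correlation_squares[of v] q.sum_correlation_squares[of v]
      by (simp add: sum.distrib sum_distrib_left[symmetric] correlation_def expectation_ising
          p.mean_def q.mean_def)
  qed
  finally show ?thesis by (simp add: mult.commute)
qed

text \<open>In the divergence formula the parameter differences are at most
  \<open>2 * \<beta>\<close>; Cauchy-Schwarz over the \<open>n * n\<close> index pairs does the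
  rest.\<close>

lemma d_SKL_le_correlation_distance:
  assumes "no_external_field n hp" "no_external_field n hq"
    "edges_bounded \<beta> n Jp" "edges_bounded \<beta> n Jq" "0 \<le> \<beta>" "0 \<le> \<epsilon>"
    and far: "\<epsilon> \<le> d_SKL (ising n hp Jp) (ising n hq Jq)"
  shows "\<epsilon>\<^sup>2 \<le> 4 * \<beta>\<^sup>2 * (real n)\<^sup>2 * correlation_distance n (correlation n hp Jp) (correlation n hq Jq)"
proof -
  define \<Delta> where "\<Delta> u v = correlation n hp Jp u v - correlation n hq Jq u v" for u v
  have "\<epsilon> \<le> (\<Sum>v<n. \<Sum>u<v. (Jp u v - Jq u v) * \<Delta> u v)"
    using far d_SKL_ising[OF assms(1,2)] by (simp add: \<Delta>_def correlation_def)
  also have "\<dots> \<le> (\<Sum>v<n. \<Sum>u<n. 2 * \<beta> * \<bar>\<Delta> u v\<bar>)"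
  proof (rule sum_mono)
    fix v assume v: "v \<in> {..<n}"
    have "(\<Sum>u<v. (Jp u v - Jq u v) * \<Delta> u v) \<le> (\<Sum>u<v. 2 * \<beta> * \<bar>\<Delta> u v\<bar>)"
    proof (rule sum_mono)
      fix u assume "u \<in> {..<v}"
      then have "\<bar>Jp u v\<bar> \<le> \<beta>" "\<bar>Jq u v\<bar> \<le> \<beta>"
        using assms(3,4) v by (auto simp: edges_bounded_def)
      then have "\<bar>Jp u v - Jq u v\<bar> * \<bar>\<Delta> u v\<bar> \<le> 2 * \<beta> * \<bar>\<Delta> u v\<bar>"
        by (intro mult_right_mono) auto
      then show "(Jp u v - Jq u v) * \<Delta> u v \<le> 2 * \<beta> * \<bar>\<Delta> u v\<bar>"
        by (metis abs_ge_self abs_mult order_trans)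
    qed
    also have "\<dots> \<le> (\<Sum>u<n. 2 * \<beta> * \<bar>\<Delta> u v\<bar>)"
      using v assms(5) by (intro sum_mono2) auto
    finally show "(\<Sum>u<v. (Jp u v - Jq u v) * \<Delta> u v) \<le> (\<Sum>u<n. 2 * \<beta> * \<bar>\<Delta> u v\<bar>)" .
  qed
  also have "\<dots> = 2 * \<beta> * (\<Sum>(v, u)\<in>{..<n} \<times> {..<n}. \<bar>\<Delta> u v\<bar>)"
    by (simp add: sum_distrib_left sum.cartesian_product case_prod_unfold)
  finally have "\<epsilon>\<^sup>2 \<le> (2 * \<beta> * (\<Sum>(v, u)\<in>{..<n} \<times> {..<n}. \<bar>\<Delta> u v\<bar>))\<^sup>2"
    using assms(6) by (rule power_mono)
  also have "\<dots> = 4 * \<beta>\<^sup>2 * (\<Sum>(v, u)\<in>{..<n} \<times> {..<n}. \<bar>\<Delta> u v\<bar>)\<^sup>2"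
    by (simp add: power_mult_distrib)
  also have "\<dots> \<le> 4 * \<beta>\<^sup>2 * ((\<Sum>(v, u)\<in>{..<n} \<times> {..<n}. (\<Delta> u v)\<^sup>2) * (real n)\<^sup>2)"
    using sum_squared_le_sum_of_squares[of "\<lambda>(v, u). \<bar>\<Delta> u v\<bar>" "{..<n} \<times> {..<n}"]
    by (intro mult_left_mono) (auto simp: case_prod_unfold power2_eq_square)
  also have "(\<Sum>(v, u)\<in>{..<n} \<times> {..<n}. (\<Delta> u v)\<^sup>2)
      = correlation_distance n (correlation n hp Jp) (correlation n hq Jq)"
    unfolding correlation_distance_def \<Delta>_def[symmetric]
    by (subst sum.swap) (simp add: sum.cartesian_product)
  finally show ?thesis by (simp add: ac_simps)
qed

text \<open>Linear combinations of the spin products are quadratic forms, so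
  \<open>variance_quadratic\<close> supplies \<open>K\<close>; the index set has
  \<open>n * n\<close> elements.\<close>

lemma split_statistic_concentration:
  fixes \<mu> :: "nat \<Rightarrow> nat \<Rightarrow> real" and D K :: real
  assumes n: "0 < n" and eta: "0 < \<eta>" and params: "ising_params n h J" "no_external_field n h"
    "high_temperature \<eta> n J" and k: "2 * k \<le> m" and a: "0 < a"
  defines "D \<equiv> correlation_distance n (correlation n h J) \<mu>" and "K \<equiv> 4 / \<eta>\<^sup>2"
  shows "measure_pmf.prob (iid_samples m (ising n h J)) {X. a \<le> \<bar>split_statistic n \<mu> k X - (real k)\<^sup>2 * D\<bar>}
    \<le> ((real k)\<^sup>2 * K\<^sup>2 * (real n)\<^sup>2 + 2 * real k ^ 3 * K * D) / a\<^sup>2"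
proof -
  interpret centered_dobrushin n "pmf (ising n h J)" "\<lambda>u v. tanh \<bar>J u v\<bar>" \<eta>
    using assms by (intro ising_centered_dobrushin) auto
  let ?p = "ising n h J" and ?T = "{..<n} \<times> {..<n}"
  let ?I = "(\<lambda>i. 2 * i) ` {..<k}" and ?J = "(\<lambda>i. 2 * i + 1) ` {..<k}"
  define W where "W x t = x (fst t) * x (snd t) - \<mu> (fst t) (snd t)" for x :: "nat \<Rightarrow> real" and t
  have fin: "finite (set_pmf ?p)" by (simp add: set_pmf_ising finite_spins)
  have int: "integrable ?p f" for f :: "_ \<Rightarrow> real"
    using fin by (rule integrable_measure_pmf_finite)
  have mean_W: "measure_pmf.expectation ?p (\<lambda>x. W x t) = correlation n h J (fst t) (snd t) - \<mu> (fst t) (snd t)" for t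
    by (simp add: W_def correlation_def int)
  have var: "measure_pmf.expectation ?p
      (\<lambda>x. (\<Sum>t\<in>?T. b t * (W x t - measure_pmf.expectation ?p (\<lambda>x. W x t)))\<^sup>2) \<le> K * (\<Sum>t\<in>?T. (b t)\<^sup>2)" for b
  proof -
    let ?Q = "quadratic_form n (\<lambda>u v. b (u, v))"
    have mean_Q: "mean ?Q = (\<Sum>t\<in>?T. b t * correlation n h J (fst t) (snd t))"
      unfolding quadratic_form_def mean_sum sum.cartesian_product
      by (intro sum.cong)
         (auto simp: mean_mult, simp add: mean_def correlation_def expectation_ising)
    have "(\<Sum>t\<in>?T. b t * (W x t - measure_pmf.expectation ?p (\<lambda>x. W x t))) = ?Q x - mean ?Q" for x
      unfolding mean_Q mean_W quadratic_form_def sum.cartesian_product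
      by (simp add: W_def case_prod_unfold right_diff_distrib sum_subtractf)
    then show ?thesis
      using variance_quadratic[of "\<lambda>u v. b (u, v)"]
      by (simp add: mean_def[of "\<lambda>x. (_ x)\<^sup>2"] expectation_ising K_def sum.cartesian_product case_prod_unfold)
  qed
  have disj: "?I \<inter> ?J = {}"
    by (auto, presburger)
  have sub: "?I \<union> ?J \<subseteq> {..<m}" using k by auto
  have card: "card ?I = k" "card ?J = k" by (auto simp: card_image inj_on_def)
  have D: "(\<Sum>t\<in>?T. (measure_pmf.expectation ?p (\<lambda>x. W x t))\<^sup>2) = D"
    unfolding D_def correlation_distance_def mean_W by (simp add: sum.cartesian_product case_prod_unfold)
  have Z: "(\<Sum>t\<in>?T. (\<Sum>i\<in>?I. W (X i) t) * (\<Sum>j\<in>?J. W (X j) t)) = split_statistic n \<mu> k X" for X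
    unfolding split_statistic_def residual_sum_def
    by (simp only: sum.cartesian_product case_prod_unfold W_def)
  show ?thesis
    using split_statistic_Chebyshev[OF fin _ _ sub _ card(1) _ card(2) disj var a, of undefined]
    unfolding iid_samples_def D Z by (simp add: power2_eq_square)
qed

text \<open>With \<open>y = h * E\<close> the numerator is at most
  \<open>h\<^sup>2 * y\<^sup>2\<close> times \<open>1 / 10000 + 1 / 50\<close>, which is below
  \<open>1 / 40\<close>, and the denominator is \<open>h\<^sup>2 * y\<^sup>2 / 4\<close>.\<close>

lemma chebyshev_ratio_le:
  fixes h K n D E :: real
  assumes h: "0 < h" and K: "0 < K" and n: "1 \<le> n" and E: "0 < E" "D \<le> E" and large: "100 * K * n \<le> h * E"
  shows "(h\<^sup>2 * K\<^sup>2 * n\<^sup>2 + 2 * h ^ 3 * K * D) / (h\<^sup>2 * E / 2)\<^sup>2 \<le> 1 / 10"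
proof -
  define y where "y = h * E"
  have y: "0 < y" using h E by (simp add: y_def)
  have "(100 * K * n)\<^sup>2 \<le> y\<^sup>2" using large K n by (intro power_mono) (auto simp: y_def)
  then have "K\<^sup>2 * n\<^sup>2 \<le> y\<^sup>2 / 10000" by (simp add: power_mult_distrib)
  moreover have "2 * K * (h * D) \<le> 2 * (y / 100) * y"
  proof -
    have "2 * K * (h * D) \<le> 2 * K * y"
      using h K E by (intro mult_left_mono) (auto simp: y_def)
    also have "\<dots> \<le> 2 * (y / 100) * y"
    proof (intro mult_right_mono)
      have "K * 1 \<le> K * n" using K n by (intro mult_left_mono) auto
      then show "2 * K \<le> 2 * (y / 100)" using large unfolding y_def by linarith
    qed (use y in simp)
    finally show ?thesis .
  qed
  ultimately have "h\<^sup>2 * (K\<^sup>2 * n\<^sup>2 + 2 * K * (h * D)) \<le> h\<^sup>2 * (y\<^sup>2 / 10000 + 2 * (y / 100) * y)"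
    by (intro mult_left_mono add_mono) auto
  also have "\<dots> \<le> h\<^sup>2 * (y\<^sup>2 / 40)"
    by (intro mult_left_mono) (auto simp: power2_eq_square)
  also have "\<dots> = 1 / 10 * (h\<^sup>2 * E / 2)\<^sup>2"
    by (simp add: y_def power2_eq_square)
  finally show ?thesis
    using h E by (simp add: pos_divide_le_eq power2_eq_square power3_eq_cube algebra_simps)
qed

lemma prob_ge_of_complement:
  assumes "measure_pmf.prob p B \<le> 1 / 10" "\<And>x. x \<notin> B \<Longrightarrow> Q x"
  shows "9 / 10 \<le> measure_pmf.prob p {x. Q x}"
proof -
  have "1 - measure_pmf.prob p B = measure_pmf.prob p (UNIV - B)"
    using measure_pmf.prob_compl[of B p] by simp
  also have "\<dots> \<le> measure_pmf.prob p {x. Q x}"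
    using assms(2) by (intro measure_pmf.finite_measure_mono) auto
  finally show ?thesis using assms(1) by simp
qed

text \<open>The program compares \<open>Z\<close> with \<open>k\<^sup>2 * E / 2\<close>. Equality
  gives \<open>D = 0\<close>, a far pair gives \<open>D \<ge> E\<close>, and in each case a
  deviation of \<open>Z\<close> below half the relevant scale yields the right answer.\<close>

lemma tester_correct:
  fixes \<beta> \<epsilon> \<eta> :: real and n m :: nat and hp hq Jp Jq
  defines "m \<equiv> sample_size (4800 / \<eta>\<^sup>2) 0 n \<beta> \<epsilon>"
  defines "p \<equiv> ising n hp Jp" and "q \<equiv> ising n hq Jq"
  defines "answer \<equiv> \<lambda>X. run tester_prog (tester_input n \<beta> \<epsilon> m (ising_description n hq Jq) X)"
  assumes eta: "0 < \<eta>" and beta: "0 \<le> \<beta>" and eps: "0 < \<epsilon>"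
    and params: "ising_params n hp Jp" "ising_params n hq Jq"
    and field: "no_external_field n hp" "no_external_field n hq"
    and temp: "high_temperature \<eta> n Jp" "high_temperature \<eta> n Jq"
    and edges: "edges_bounded \<beta> n Jp" "edges_bounded \<beta> n Jq"
  shows "p = q \<Longrightarrow> measure_pmf.prob (iid_samples m p) {X. answer X = 1} \<ge> 9 / 10"
    and "d_SKL p q \<ge> \<epsilon> \<Longrightarrow> measure_pmf.prob (iid_samples m p) {X. answer X = 0} \<ge> 9 / 10"
proof -
  define \<mu> where "\<mu> = correlation n hq Jq"
  define D where "D = correlation_distance n (correlation n hp Jp) \<mu>"
  define k where "k = m div 2"
  define Z where "Z = split_statistic n \<mu> k"
  define K where "K = 4 / \<eta>\<^sup>2"
  define f where "f = real n powr (10 / 3) * \<beta>\<^sup>2 / \<epsilon>\<^sup>2"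
  \<comment> \<open>The least correlation distance compatible with divergence
    \<open>\<epsilon>\<close>.\<close>
  define E where "E = \<epsilon>\<^sup>2 / (4 * \<beta>\<^sup>2 * (real n)\<^sup>2)"
  have K: "0 < K" using eta by (simp add: K_def)
  have k_le: "2 * k \<le> m" by (simp add: k_def)
  have m: "m = nat \<lceil>4800 / \<eta>\<^sup>2 * f\<rceil>"
    unfolding m_def sample_size_def f_def Let_def by (simp only: power_0 mult_1_right)
  have far: "\<epsilon>\<^sup>2 \<le> 4 * \<beta>\<^sup>2 * (real n)\<^sup>2 * D" if "\<epsilon> \<le> d_SKL p q"
    using d_SKL_le_correlation_distance[OF field edges beta less_imp_le[OF eps]] that
    by (simp add: D_def \<mu>_def p_def q_def)
  have answer: "answer X = (if \<epsilon>\<^sup>2 * (real k)\<^sup>2 < 8 * \<beta>\<^sup>2 * (real n)\<^sup>2 * Z X then 0 else 1)" for X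
    unfolding answer_def Z_def k_def \<mu>_def correlation_def[abs_def] by (rule run_tester_prog)
  have f_lower: "real n ^ 3 * \<beta>\<^sup>2 / \<epsilon>\<^sup>2 \<le> f" if "0 < n"
  proof -
    have "real n ^ 3 = real n powr 3" using that by simp
    also have "\<dots> \<le> real n powr (10 / 3)" using that by (intro powr_mono) auto
    finally show ?thesis
      unfolding f_def by (intro divide_right_mono mult_right_mono) auto
  qed
  have answer_iff: "answer X = (if (real k)\<^sup>2 * E / 2 < Z X then 0 else 1)" if "0 < \<beta>" "0 < n" for X
    using that by (simp add: answer E_def field_simps)
  have E_pos: "0 < E" if "0 < \<beta>" "0 < n"
    using that eps by (simp add: E_def)
  \<comment> \<open>The constant 4800 is chosen here: \<open>E\<close> contributes
    \<open>1 / 4\<close>, \<open>K\<close> contributes 4, and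
    \<open>m \<le> 2 * k + 1 \<le> 3 * k\<close> for positive \<open>k\<close>, so
    \<open>4800 / 4 = 3 * 100 * 4\<close>.\<close>
  have large: "100 * K * n \<le> k * E" if "0 < \<beta>" "0 < n" "0 < k"
  proof -
    have "4800 / \<eta>\<^sup>2 * (real n ^ 3 * \<beta>\<^sup>2 / \<epsilon>\<^sup>2) \<le> 4800 / \<eta>\<^sup>2 * f"
      using f_lower[OF that(2)] eta by (intro mult_left_mono) auto
    also have "\<dots> \<le> m" unfolding m by linarith
    also have "real m \<le> 3 * k" using that(3) by (simp add: k_def)
    finally have "4800 / \<eta>\<^sup>2 * (real n ^ 3 * \<beta>\<^sup>2 / \<epsilon>\<^sup>2) * E \<le> 3 * k * E"
      using E_pos[OF that(1,2)] by (intro mult_right_mono) auto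
    also have "4800 / \<eta>\<^sup>2 * (real n ^ 3 * \<beta>\<^sup>2 / \<epsilon>\<^sup>2) * E = 3 * (100 * K * n)"
      using that eps eta by (simp add: E_def K_def field_simps power2_eq_square power3_eq_cube)
    finally show ?thesis by linarith
  qed
  \<comment> \<open>The variance grows with \<open>D\<close>, so the scale \<open>E'\<close> is left
    open: it is \<open>E\<close> when \<open>p = q\<close> and \<open>D\<close> for a far
    pair.\<close>
  have prob: "measure_pmf.prob (iid_samples m p) {X. (real k)\<^sup>2 * E' / 2 \<le> \<bar>Z X - (real k)\<^sup>2 * D\<bar>} \<le> 1 / 10"
    if "0 < \<beta>" "0 < n" "0 < k" "D \<le> E'" "E \<le> E'" for E'
  proof -
    have E': "0 < E'" using E_pos that by fastforce
    have "100 * K * n \<le> k * E'"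
      using large[OF that(1-3)] mult_left_mono[OF that(5), of "real k"] by simp
    then have ratio: "((real k)\<^sup>2 * K\<^sup>2 * (real n)\<^sup>2 + 2 * real k ^ 3 * K * D) / ((real k)\<^sup>2 * E' / 2)\<^sup>2 \<le> 1 / 10"
      using that K E' by (intro chebyshev_ratio_le) auto
    have pos: "0 < (real k)\<^sup>2 * E' / 2" using that E' by simp
    show ?thesis
      unfolding Z_def D_def p_def
      by (rule order_trans[OF split_statistic_concentration[OF that(2) eta params(1) field(1) temp(1) k_le pos]
            ratio[unfolded D_def K_def]])
  qed
  show "measure_pmf.prob (iid_samples m p) {X. answer X = 1} \<ge> 9 / 10" if "p = q"
  proof (cases "0 < \<beta> \<and> 0 < n \<and> 0 < k")
    case True
    have D: "D = 0"
      using that by (simp add: D_def \<mu>_def correlation_distance_def correlation_def p_def q_def)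
    show ?thesis
    proof (rule prob_ge_of_complement)
      show "measure_pmf.prob (iid_samples m p) {X. (real k)\<^sup>2 * E / 2 \<le> \<bar>Z X - (real k)\<^sup>2 * D\<bar>} \<le> 1 / 10"
        using True D E_pos by (intro prob) auto
      show "answer X = 1" if "X \<notin> {X. (real k)\<^sup>2 * E / 2 \<le> \<bar>Z X - (real k)\<^sup>2 * D\<bar>}" for X
        using that True by (simp add: answer_iff D)
    qed
  next
    case False
    then have "\<beta> = 0 \<or> n = 0 \<or> k = 0" using beta by auto
    \<comment> \<open>In the degenerate cases the right side of the strict comparison is 0, so it
      fails and the program accepts.\<close>
    then have "answer X = 1" for X
      by (auto simp: answer Z_def split_statistic_def residual_sum_def not_less)
    then show ?thesis by simp
  qed
  show "measure_pmf.prob (iid_samples m p) {X. answer X = 0} \<ge> 9 / 10" if d: "\<epsilon> \<le> d_SKL p q"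
  proof -
    have far': "\<epsilon>\<^sup>2 \<le> 4 * \<beta>\<^sup>2 * (real n)\<^sup>2 * D" using far[OF d] .
    have "n \<noteq> 0" "\<beta> \<noteq> 0" using far' eps by (intro notI, simp)+
    with beta have n: "0 < n" and beta': "0 < \<beta>" by simp_all
    interpret dobrushin n "pmf (ising n hp Jp)" "\<lambda>u v. tanh \<bar>Jp u v\<bar>" \<eta>
      using n params temp eta by (intro ising_dobrushin) auto
    \<comment> \<open>Together with the lower bound \<open>far'\<close> this forces
      \<open>f \<ge> \<eta> / 16\<close>, hence at least two samples and a positive
      \<open>k\<close>.\<close>
    have "D \<le> 4 * real n / \<eta>"
      unfolding D_def \<mu>_def using n eta params field temp by (rule correlation_distance_le)
    then have "4 * \<beta>\<^sup>2 * (real n)\<^sup>2 * D \<le> 4 * \<beta>\<^sup>2 * (real n)\<^sup>2 * (4 * n / \<eta>)"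
      by (intro mult_left_mono) auto
    with far' have "\<epsilon>\<^sup>2 \<le> 4 * \<beta>\<^sup>2 * (real n)\<^sup>2 * (4 * real n / \<eta>)" by linarith
    also have "\<dots> = 16 * (real n ^ 3 * \<beta>\<^sup>2) / \<eta>"
      by (simp add: power2_eq_square power3_eq_cube)
    finally have "\<eta> * \<epsilon>\<^sup>2 \<le> 16 * (real n ^ 3 * \<beta>\<^sup>2)"
      using eta by (simp add: field_simps)
    then have "\<eta> / 16 \<le> real n ^ 3 * \<beta>\<^sup>2 / \<epsilon>\<^sup>2"
      using eps by (simp add: field_simps)
    also have "\<dots> \<le> f" by (rule f_lower[OF n])
    finally have "4800 / \<eta>\<^sup>2 * (\<eta> / 16) \<le> 4800 / \<eta>\<^sup>2 * f"
      using eta by (intro mult_left_mono) auto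
    moreover have "4800 / \<eta>\<^sup>2 * (\<eta> / 16) = 300 / \<eta>"
      using eta by (simp add: power2_eq_square)
    moreover have "300 \<le> 300 / \<eta>" using eta_le_one eta by (simp add: field_simps)
    ultimately have "2 \<le> m" unfolding m by linarith
    then have k: "0 < k" by (simp add: k_def)
    have E_le: "E \<le> D" using far' n beta' by (simp add: E_def field_simps)
    show ?thesis
    proof (rule prob_ge_of_complement)
      show "measure_pmf.prob (iid_samples m p) {X. (real k)\<^sup>2 * D / 2 \<le> \<bar>Z X - (real k)\<^sup>2 * D\<bar>} \<le> 1 / 10"
        using n beta' k E_le by (intro prob) auto
      fix X assume "X \<notin> {X. (real k)\<^sup>2 * D / 2 \<le> \<bar>Z X - (real k)\<^sup>2 * D\<bar>}"
      then have "(real k)\<^sup>2 * D / 2 < Z X" unfolding mem_Collect_eq by linarith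
      moreover have "(real k)\<^sup>2 * E \<le> (real k)\<^sup>2 * D" using E_le by (intro mult_left_mono) auto
      ultimately show "answer X = 0" by (simp add: answer_iff[OF beta' n])
    qed
  qed
qed

theorem theorem10:
  fixes \<eta> :: real
  assumes "\<eta> > 0"
  shows "\<exists>(A :: prog) (C :: real) (k :: nat). C > 0 \<and>
    (\<forall>(n :: nat) (\<beta> :: real) (\<epsilon> :: real) hp Jp hq Jq.
       0 \<le> \<beta> \<longrightarrow> 0 < \<epsilon> \<longrightarrow>
       ising_params n hp Jp \<longrightarrow> ising_params n hq Jq \<longrightarrow>
       no_external_field n hp \<longrightarrow> no_external_field n hq \<longrightarrow>
       high_temperature \<eta> n Jp \<longrightarrow> high_temperature \<eta> n Jq \<longrightarrow>
       edges_bounded \<beta> n Jp \<longrightarrow> edges_bounded \<beta> n Jq \<longrightarrow>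
       (let p = ising n hp Jp;
            q = ising n hq Jq;
            m = sample_size C k n \<beta> \<epsilon>;
            answer = (\<lambda>X. run A (tester_input n \<beta> \<epsilon> m (ising_description n hq Jq) X))
        in (p = q \<longrightarrow>
              measure_pmf.prob (iid_samples m p) {X. answer X = 1} \<ge> 9 / 10) \<and>
           (d_SKL p q \<ge> \<epsilon> \<longrightarrow>
              measure_pmf.prob (iid_samples m p) {X. answer X = 0} \<ge> 9 / 10)))"
proof (intro exI conjI allI impI)
  \<comment> \<open>The witness for \<open>C\<close>; the logarithm gets exponent 0, and
    \<open>tester_prog\<close> is the same program for every \<open>\<eta>\<close>.\<close>
  show "0 < 4800 / \<eta>\<^sup>2" using assms by simp
  fix n :: nat and \<beta> \<epsilon> :: real and hp Jp hq Jq
  assume "0 \<le> \<beta>" "0 < \<epsilon>" "ising_params n hp Jp" "ising_params n hq Jq"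
    "no_external_field n hp" "no_external_field n hq"
    "high_temperature \<eta> n Jp" "high_temperature \<eta> n Jq"
    "edges_bounded \<beta> n Jp" "edges_bounded \<beta> n Jq"
  note tester_correct[OF assms this]
  then show "let p = ising n hp Jp;
            q = ising n hq Jq;
            m = sample_size (4800 / \<eta>\<^sup>2) 0 n \<beta> \<epsilon>;
            answer = (\<lambda>X. run tester_prog (tester_input n \<beta> \<epsilon> m (ising_description n hq Jq) X))
        in (p = q \<longrightarrow>
              measure_pmf.prob (iid_samples m p) {X. answer X = 1} \<ge> 9 / 10) \<and>
           (d_SKL p q \<ge> \<epsilon> \<longrightarrow>
              measure_pmf.prob (iid_samples m p) {X. answer X = 0} \<ge> 9 / 10)"
    unfolding Let_def by blast
qed

end
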